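(* Consider the complex compound MISO broadcast channel with $K=2$ users, $M=2$ antennas at the transmitter, and $J_1=1$, $J_2=3$ generic channel states for users $1$ and $2$ respectively. Then, almost surely (with respect to the draw of the channel states), the exact total number of degrees of freedom is $d=\frac{3}{2}$.
   Context: Complex compound MISO broadcast channel. A transmitter with $M>1$ antennas communicates with $K$ single-antenna receivers. For each user $k\in\{1,\dots,K\}$ there is a finite set of $J_k$ possible channel vectors (states) $\mathbf{h}^{[k]}_{1},\dots,\mathbf{h}^{[k]}_{J_k}\in\mathbb{C}^{1\times M}$. If user $k$ is in state $j_k\in\{1,\dots,J_k\}$, its received signal at time $t$ is $$y^{[k]}_{j_k}(t)=\mathbf{h}^{[k]}_{j_k}\mathbf{x}(t)+z^{[k]}_{j_k}(t),$$ where $\mathbf{x}(t)\in\mathbb{C}^{M\times 1}$ is the transmitted vector, subject to the average power constraint $E(\|\mathbf{x}\|^2)\le P$ (averaged over the codeword), and the noise $z^{[k]}_{j_k}(t)$ is i.i.d. zero-mean unit-variance circularly symmetric complex Gaussian. The state of each user is fixed throughout the duration of communication. The sets of possible states are known to all nodes and do not depend on $P$; the transmitter does not know which states are realized, while the receivers have perfect channel knowledge. Generic states / almost surely. All the coefficients of all possible states are drawn from a continuous distribution (absolutely continuous with respect to Lebesgue measure), and "almost surely" refers to this draw. Achievable rates. The transmitter sends independent messages $W^{[k]}$ of rate $R^{[k]}$ to receiver $k$, $k=1,\dots,K$. A rate tuple $(R^{[1]},\dots,R^{[K]})$ is achievable at power $P$ if there are codes (encoder not depending on the realized states) of growing block length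 such that every receiver $k$ decodes $W^{[k]}$ with arbitrarily small error probability, regardless of which state is realized. Degrees of freedom. The total number of degrees of freedom is $$d=\lim_{P\to\infty}\frac{C_\Sigma(P)}{\log P},$$ where $C_\Sigma(P)$ is the supremum of $R^{[1]}+\cdots+R^{[K]}$ over all rate tuples achievable at power $P$. *)

theory Defs
  imports "HOL-Probability.Probability"
begin

text \<open>
  Users are indexed by \<open>{1..K}\<close> and the states of user \<open>k\<close> by \<open>{1..J k}\<close>. A family of channel
  vectors is a function \<open>h\<close>, with \<open>h (k, j)\<close> the channel vector of user \<open>k\<close> in state \<open>j\<close>; the
  transmit antennas are indexed by the type \<open>'m\<close>.
\<close>

definition states :: "nat \<Rightarrow> (nat \<Rightarrow> nat) \<Rightarrow> (nat \<times> nat) set" where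
  "states K J = Sigma {1..K} (\<lambda>k. {1..J k})"

text \<open>
  Joint laws of the coefficients of all states that are absolutely continuous with respect to
  Lebesgue measure. The coefficients need not be independent.
\<close>

definition continuous_channel_law ::
  "nat \<Rightarrow> (nat \<Rightarrow> nat) \<Rightarrow> (nat \<times> nat \<Rightarrow> complex ^ 'm::finite) measure \<Rightarrow> bool" where
  "continuous_channel_law K J \<mu> \<longleftrightarrow>
     prob_space \<mu> \<and>
     sets \<mu> = sets (Pi\<^sub>M (states K J) (\<lambda>_. lborel)) \<and>
     absolutely_continuous (Pi\<^sub>M (states K J) (\<lambda>_. lborel)) \<mu>"

text \<open>
  Circularly symmetric complex Gaussian noise of unit variance: independent real and imaginary
  parts, each of variance \<open>1/2\<close>.
\<close>

definition complex_normal :: "complex measure" where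
  "complex_normal =
     (let N = density lborel (normal_density 0 (1 / sqrt 2))
      in distr (N \<Otimes>\<^sub>M N) borel (\<lambda>(a, b). Complex a b))"

definition noise :: "nat \<Rightarrow> (nat \<Rightarrow> complex) measure" where
  "noise n = Pi\<^sub>M {..<n} (\<lambda>_. complex_normal)"

text \<open>The matrix product of a row and a column vector; there is no complex conjugation.\<close>

definition row_times :: "complex ^ 'm::finite \<Rightarrow> complex ^ 'm \<Rightarrow> complex" where
  "row_times h x = (\<Sum>i\<in>UNIV. h $ i * x $ i)"

definition received ::
  "nat \<Rightarrow> complex ^ 'm::finite \<Rightarrow> (nat \<Rightarrow> complex ^ 'm) \<Rightarrow> (nat \<Rightarrow> complex) \<Rightarrow> nat \<Rightarrow> complex" where
  "received n h x z = (\<lambda>t\<in>{..<n}. row_times h (x t) + z t)"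

text \<open>
  Message tuples \<open>w\<close>, where user \<open>k\<close> has the \<open>m k\<close> messages \<open>w k \<in> {..<m k}\<close>. The independent
  messages are uniformly distributed, so that expectations over them are averages over this set.
\<close>

definition messages :: "nat \<Rightarrow> (nat \<Rightarrow> nat) \<Rightarrow> (nat \<Rightarrow> nat) set" where
  "messages K m = Pi\<^sub>E {1..K} (\<lambda>k. {..<m k})"

definition avg_power ::
  "nat \<Rightarrow> (nat \<Rightarrow> nat) \<Rightarrow> nat \<Rightarrow> ((nat \<Rightarrow> nat) \<Rightarrow> nat \<Rightarrow> complex ^ 'm::finite) \<Rightarrow> real" where
  "avg_power K m n x =
     (\<Sum>w\<in>messages K m. (\<Sum>t<n. (norm (x w t))\<^sup>2) / real n) / real (card (messages K m))"

text \<open>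
  Error probability of user \<open>k\<close> with channel vector \<open>h\<close> and decoder \<open>g\<close>, under the encoder \<open>x\<close>.
\<close>

definition error_prob ::
  "nat \<Rightarrow> (nat \<Rightarrow> nat) \<Rightarrow> nat \<Rightarrow> ((nat \<Rightarrow> nat) \<Rightarrow> nat \<Rightarrow> complex ^ 'm::finite) \<Rightarrow>
    nat \<Rightarrow> complex ^ 'm \<Rightarrow> ((nat \<Rightarrow> complex) \<Rightarrow> nat) \<Rightarrow> real" where
  "error_prob K m n x k h g =
     (\<Sum>w\<in>messages K m. \<P>(z in noise n. g (received n h (x w) z) \<noteq> w k))
       / real (card (messages K m))"

text \<open>
  The encoder \<open>x\<close> is the same for all realizations of the states, while the decoder \<open>g (k, j)\<close> of
  user \<open>k\<close> may depend on its state \<open>j\<close>. Both may depend on the whole family \<open>h\<close>, which is known to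
  all nodes. Rates are in bits per channel use.
\<close>

definition achievable ::
  "nat \<Rightarrow> (nat \<Rightarrow> nat) \<Rightarrow> (nat \<times> nat \<Rightarrow> complex ^ 'm::finite) \<Rightarrow> real \<Rightarrow> (nat \<Rightarrow> real) \<Rightarrow> bool" where
  "achievable K J h P R \<longleftrightarrow>
     (\<forall>k\<in>{1..K}. 0 \<le> R k) \<and>
     (\<forall>\<epsilon>>0. \<forall>n0. \<exists>n\<ge>n0. \<exists>m x g.
        (\<forall>k\<in>{1..K}. 2 powr (real n * R k) \<le> real (m k)) \<and>
        avg_power K m n x \<le> P \<and>
        (\<forall>(k, j)\<in>states K J.
           g (k, j) \<in> measurable (Pi\<^sub>M {..<n} (\<lambda>_. borel)) (count_space UNIV) \<and>
           error_prob K m n x k (h (k, j)) (g (k, j)) \<le> \<epsilon>))"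

definition sum_capacity ::
  "nat \<Rightarrow> (nat \<Rightarrow> nat) \<Rightarrow> (nat \<times> nat \<Rightarrow> complex ^ 'm::finite) \<Rightarrow> real \<Rightarrow> ereal" where
  "sum_capacity K J h P = (SUP R\<in>{R. achievable K J h P R}. ereal (\<Sum>k=1..K. R k))"

definition has_dof ::
  "nat \<Rightarrow> (nat \<Rightarrow> nat) \<Rightarrow> (nat \<times> nat \<Rightarrow> complex ^ 'm::finite) \<Rightarrow> real \<Rightarrow> bool" where
  "has_dof K J h d \<longleftrightarrow>
     ((\<lambda>P. sum_capacity K J h P / ereal (log 2 P)) \<longlongrightarrow> ereal d) at_top"

end

theory Submission
  imports Defs
begin

text \<open>
  Achievability. User 1 gets two real streams and user 2 one real stream. The stream of user 2 is
  zero-forced at user 1. The two streams of user 1 are sent along \<open>v1\<close>, \<open>v2\<close> with \<open>v1\<close> in the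
  kernel of the first and \<open>v2\<close> in the kernel of the second state of user 2, scaled to agree at the
  third state: at every state of user 2 they then lie on one real line, while they are
  \<open>\<real>\<close>-independent at user 1 because the cross ratio of the four channels is not real. Projecting
  away the interference leaves point-to-point real channels, for which a Gilbert--Varshamov packing
  of the cube \<open>{0..<q}\<^sup>n\<close>, with \<open>q\<close> of order \<open>sqrt P\<close>, achieves \<open>1/2 log P - O(1)\<close>.

  Converse. The entropy inequality \<open>R1 + 2 R2 \<le> 2 log P + O(1)\<close> is replaced by a volume count. The
  decoding regions of user 2 at each of two states are disjoint subsets of a set of volume
  \<open>(C P)\<^sup>n\<close>, so that some message of user 2 has regions of volume at most a constant times
  \<open>(C P)\<^sup>n / m2\<close> at both states; the product of these two regions must host essentially all the
  \<open>m1\<close> messages of user 1, whence \<open>m1 m2\<^sup>2 \<le> (C' P\<^sup>2)\<^sup>n\<close>. Together with \<open>m1 \<le> (C P)\<^sup>n\<close> this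
  gives \<open>R1 + R2 \<le> 3/2 log P + O(1)\<close>.
\<close>

subsection \<open>Complex Gaussian noise\<close>

lemma measurable_Complex_pair [measurable]:
  "(\<lambda>(a, b). Complex a b) \<in> borel \<Otimes>\<^sub>M borel \<rightarrow>\<^sub>M borel"
proof -
  have "(\<lambda>p. complex_of_real (fst p) + \<i> * complex_of_real (snd p)) \<in> borel_measurable (borel :: (real \<times> real) measure)"
    by (intro borel_measurable_continuous_onI continuous_intros)
  then show ?thesis
    by (simp add: borel_prod case_prod_unfold Complex_eq)
qed

text \<open>Reduces complex integrals to iterated real ones: the preimage of a complex box is a
  product of two real intervals, and the values on boxes determine Lebesgue measure.\<close>

lemma lborel_complex:
  "(lborel :: complex measure) = distr (lborel \<Otimes>\<^sub>M lborel) borel (\<lambda>(a, b). Complex a b)"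
proof (rule lborel_eqI)
  fix l u :: complex
  assume le: "\<And>b. b \<in> Basis \<Longrightarrow> l \<bullet> b \<le> u \<bullet> b"
  have eq: "(\<lambda>(a, b). Complex a b) -` box l u \<inter> space (lborel \<Otimes>\<^sub>M lborel)
      = box (Re l) (Re u) \<times> box (Im l) (Im u)"
    by (auto simp: in_box_complex_iff space_pair_measure)
  have "Re l \<le> Re u" "Im l \<le> Im u"
    using le[of 1] le[of \<i>] by (auto simp: Basis_complex_def)
  then show "emeasure (distr (lborel \<Otimes>\<^sub>M lborel) borel (\<lambda>(a, b). Complex a b)) (box l u)
      = (\<Prod>b\<in>Basis. (u - l) \<bullet> b)"
    by (subst emeasure_distr)
       (simp_all add: eq lborel.emeasure_pair_measure_Times Basis_complex_def ennreal_mult mult.commute)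
qed simp

lemma nn_integral_lborel_complex:
  assumes [measurable]: "f \<in> borel_measurable borel"
  shows "(\<integral>\<^sup>+z. f z \<partial>(lborel :: complex measure)) = (\<integral>\<^sup>+a. \<integral>\<^sup>+b. f (Complex a b) \<partial>lborel \<partial>lborel)"
proof -
  have "(\<integral>\<^sup>+z. f z \<partial>(lborel :: complex measure)) = (\<integral>\<^sup>+p. f (case p of (a, b) \<Rightarrow> Complex a b) \<partial>(lborel \<Otimes>\<^sub>M lborel))"
    by (subst lborel_complex, subst nn_integral_distr) auto
  also have "\<dots> = (\<integral>\<^sup>+a. \<integral>\<^sup>+b. f (Complex a b) \<partial>lborel \<partial>lborel)"
    by (subst lborel.nn_integral_fst[symmetric]) auto
  finally show ?thesis .
qed

text \<open>Two independent real normals of variance 1/2 have the joint density exp(-|z|^2) /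
  pi.\<close>

lemma nn_integral_complex_normal:
  assumes [measurable]: "f \<in> borel_measurable borel"
  shows "(\<integral>\<^sup>+z. f z \<partial>complex_normal) =
    (\<integral>\<^sup>+z. ennreal (exp (- (norm z)\<^sup>2) / pi) * f z \<partial>lborel)"
proof -
  let ?d = "normal_density 0 (1 / sqrt 2)"
  let ?N = "density lborel ?d"
  interpret N: prob_space ?N
    by (rule prob_space_normal_density) simp
  have d: "?d a * ?d b = exp (- (norm (Complex a b))\<^sup>2) / pi" for a b
    by (simp add: normal_density_def complex_norm exp_add[symmetric] power_divide field_simps real_sqrt_mult)
  have s [measurable_cong]: "sets ?N = sets borel" by simp
  have "(\<integral>\<^sup>+z. f z \<partial>complex_normal) = (\<integral>\<^sup>+p. f (case p of (a, b) \<Rightarrow> Complex a b) \<partial>(?N \<Otimes>\<^sub>M ?N))"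
    unfolding complex_normal_def Let_def
    by (subst nn_integral_distr) auto
  also have "\<dots> = (\<integral>\<^sup>+a. \<integral>\<^sup>+b. f (Complex a b) \<partial>?N \<partial>?N)"
    by (subst N.nn_integral_fst[symmetric]) auto
  also have "\<dots> = (\<integral>\<^sup>+a. ?d a * (\<integral>\<^sup>+b. ?d b * f (Complex a b) \<partial>lborel) \<partial>lborel)"
    by (subst nn_integral_density; (subst nn_integral_density)?) auto
  also have "\<dots> = (\<integral>\<^sup>+a. \<integral>\<^sup>+b. ?d a * (?d b * f (Complex a b)) \<partial>lborel \<partial>lborel)"
    by (intro nn_integral_cong nn_integral_cmult[symmetric]) auto
  also have "\<dots> = (\<integral>\<^sup>+a. \<integral>\<^sup>+b. ennreal (exp (- (norm (Complex a b))\<^sup>2) / pi) * f (Complex a b) \<partial>lborel \<partial>lborel)"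
    by (simp add: d[symmetric] ennreal_mult mult.assoc)
  also have "\<dots> = (\<integral>\<^sup>+z. ennreal (exp (- (norm z)\<^sup>2) / pi) * f z \<partial>lborel)"
    by (subst nn_integral_lborel_complex) auto
  finally show ?thesis .
qed

lemma prob_space_complex_normal: "prob_space complex_normal"
proof -
  have "prob_space (density lborel (normal_density 0 (1 / sqrt 2)))"
    by (rule prob_space_normal_density) simp
  then interpret N: pair_prob_space "density lborel (normal_density 0 (1 / sqrt 2))"
      "density lborel (normal_density 0 (1 / sqrt 2))"
    by (simp add: pair_prob_space_def pair_sigma_finite_def prob_space_imp_sigma_finite)
  show ?thesis
    unfolding complex_normal_def Let_def by (rule N.P.prob_space_distr) simp
qed

lemma sets_complex_normal [simp, measurable_cong]: "sets complex_normal = sets borel"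
  by (simp add: complex_normal_def Let_def)

lemma space_complex_normal [simp]: "space complex_normal = UNIV"
  by (simp add: complex_normal_def Let_def)

text \<open>The integrand is \<open>pi * r\<close> times a product of two normal densities of
  variance \<open>r / 2\<close>, one in the real and one in the imaginary part.\<close>

lemma nn_integral_exp_norm_square:
  assumes "0 < r"
  shows "(\<integral>\<^sup>+z. ennreal (exp (- ((norm z)\<^sup>2 / r))) \<partial>(lborel :: complex measure)) = ennreal (pi * r)"
proof -
  let ?s = "sqrt (r / 2)"
  have d: "ennreal (exp (- ((norm (Complex a b))\<^sup>2 / r))) =
      ennreal (pi * r) * (ennreal (normal_density 0 ?s a) * ennreal (normal_density 0 ?s b))" for a b
    using assms
    by (simp add: normal_density_def complex_norm exp_add[symmetric] ennreal_mult[symmetric]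
        add_divide_distrib)
  have i: "(\<integral>\<^sup>+b. ennreal (normal_density 0 ?s b) \<partial>lborel) = 1"
    using assms by (subst nn_integral_eq_integral) auto
  show ?thesis
    by (subst nn_integral_lborel_complex) (auto simp: d nn_integral_cmult i)
qed

text \<open>The noise density is at most 1 / pi, hence at most 1, and Lebesgue measure is
  translation invariant. This is what lets the converse trade noise probabilities for
  volumes.\<close>

lemma nn_integral_translate_complex_normal_le:
  assumes [measurable]: "f \<in> borel_measurable borel"
  shows "(\<integral>\<^sup>+z. f (c + z) \<partial>complex_normal) \<le> (\<integral>\<^sup>+z. f z \<partial>lborel)"
proof -
  have *: "ennreal (exp (- (norm z)\<^sup>2) / pi) * f (c + z) \<le> f (c + z)" for z
  proof -
    have "exp (- (norm z)\<^sup>2) \<le> 1" by simp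
    then have "exp (- (norm z)\<^sup>2) \<le> pi"
      using pi_ge_two by linarith
    then have "ennreal (exp (- (norm z)\<^sup>2) / pi) * f (c + z) \<le> 1 * f (c + z)"
      by (intro mult_right_mono) auto
    then show ?thesis by simp
  qed
  have "(\<integral>\<^sup>+z. f (c + z) \<partial>complex_normal) \<le> (\<integral>\<^sup>+z. f (c + z) \<partial>lborel)"
    by (subst nn_integral_complex_normal) (auto intro!: nn_integral_mono *)
  also have "\<dots> = (\<integral>\<^sup>+z. f z \<partial>distr lborel borel ((+) c))"
    by (subst nn_integral_distr) auto
  finally show ?thesis
    by (simp add: lborel_distr_plus)
qed

text \<open>The exponential moment for the Chernoff bound in \<open>noise_tail\<close>: the weight
  turns the density into exp(-|z|^2 / 2) / pi, of total mass 2.\<close>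

lemma nn_integral_complex_normal_exp_half:
  "(\<integral>\<^sup>+z. ennreal (exp ((norm z)\<^sup>2 / 2)) \<partial>complex_normal) = 2"
proof -
  have "(\<integral>\<^sup>+z. ennreal (exp ((norm z)\<^sup>2 / 2)) \<partial>complex_normal)
      = (\<integral>\<^sup>+z. ennreal (1 / pi) * ennreal (exp (- ((norm z)\<^sup>2 / 2))) \<partial>(lborel :: complex measure))"
    by (subst nn_integral_complex_normal)
       (auto intro!: nn_integral_cong simp: ennreal_mult[symmetric] exp_add[symmetric] field_simps exp_diff exp_minus)
  also have "\<dots> = ennreal (1 / pi) * ennreal (pi * 2)"
    by (subst nn_integral_cmult) (auto simp: nn_integral_exp_norm_square)
  also have "\<dots> = 2"
    by (simp add: ennreal_mult[symmetric])
  finally show ?thesis .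
qed

section \<open>Noise and Lebesgue measure over a block of \<open>n\<close> channel uses\<close>

interpretation lborel_prod: product_sigma_finite "\<lambda>_::nat. lborel :: complex measure"
  by standard

interpretation noise_prod: product_sigma_finite "\<lambda>_::nat. complex_normal"
  by (simp add: product_sigma_finite_def prob_space_imp_sigma_finite prob_space_complex_normal)

abbreviation leb :: "nat \<Rightarrow> (nat \<Rightarrow> complex) measure" where
  "leb n \<equiv> Pi\<^sub>M {..<n} (\<lambda>_. lborel)"

lemma prob_space_noise: "prob_space (noise n)"
  unfolding noise_def by (intro prob_space_PiM prob_space_complex_normal)

lemma sets_noise [simp, measurable_cong]: "sets (noise n) = sets (Pi\<^sub>M {..<n} (\<lambda>_. borel))"
  unfolding noise_def by (intro sets_PiM_cong) auto

lemma space_noise [simp]: "space (noise n) = space (Pi\<^sub>M {..<n} (\<lambda>_. borel))"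
  by (rule sets_eq_imp_space_eq) simp

lemma sets_leb [measurable_cong]: "sets (leb n) = sets (Pi\<^sub>M {..<n} (\<lambda>_. borel))"
  by (intro sets_PiM_cong) auto

lemma space_leb [simp]: "space (leb n) = space (Pi\<^sub>M {..<n} (\<lambda>_. borel))"
  by (rule sets_eq_imp_space_eq) (rule sets_leb)

text \<open>Induction on the block length: the last coordinate is integrated first, by the
  one-dimensional bound, and the induction hypothesis applies to the resulting function
  \<open>g\<close> of the other coordinates.\<close>

lemma nn_integral_translate_noise_le:
  assumes "f \<in> borel_measurable (Pi\<^sub>M {..<n} (\<lambda>_. borel))"
  shows "(\<integral>\<^sup>+z. f (\<lambda>t\<in>{..<n}. c t + z t) \<partial>noise n) \<le> (\<integral>\<^sup>+y. f y \<partial>leb n)"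
  using assms
proof (induction n arbitrary: f)
  case 0
  \<comment> \<open>With no coordinates both integrals evaluate \<open>f\<close> at a single point,
    the function that is \<open>undefined\<close> everywhere.\<close>
  have "(\<lambda>t\<in>{}. g t) = (\<lambda>_. undefined)" for g :: "nat \<Rightarrow> complex"
    by auto
  then show ?case
    by (simp add: noise_def PiM_empty nn_integral_count_space_finite)
next
  case (Suc n)
  note f [measurable] = Suc.prems
  let ?T = "\<lambda>z :: nat \<Rightarrow> complex. (\<lambda>t\<in>{..<n}. c t + z t)"
  define g where "g z = (\<integral>\<^sup>+y. f (z(n := y)) \<partial>lborel)" for z :: "nat \<Rightarrow> complex"
  have upd [measurable]: "(\<lambda>(z, y). z(n := y)) \<in>
      Pi\<^sub>M {..<n} (\<lambda>_. borel) \<Otimes>\<^sub>M borel \<rightarrow>\<^sub>M Pi\<^sub>M {..<Suc n} (\<lambda>_. borel :: complex measure)"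
    using measurable_add_dim[of n "{..<n}" "\<lambda>_. borel :: complex measure"] by (simp add: lessThan_Suc)
  have fm: "(\<lambda>y. f (z(n := y))) \<in> borel_measurable borel"
    if "z \<in> space (Pi\<^sub>M {..<n} (\<lambda>_. borel))" for z
  proof -
    have "(\<lambda>y. (z, y)) \<in> borel \<rightarrow>\<^sub>M Pi\<^sub>M {..<n} (\<lambda>_. borel) \<Otimes>\<^sub>M borel"
      using that by measurable
    from measurable_compose[OF measurable_compose[OF this upd] f] show ?thesis
      by (simp add: fun_upd_def)
  qed
  have gm: "g \<in> borel_measurable (Pi\<^sub>M {..<n} (\<lambda>_. borel))"
  proof -
    have "(\<lambda>(z, y). f (z(n := y))) \<in> borel_measurable (Pi\<^sub>M {..<n} (\<lambda>_. borel) \<Otimes>\<^sub>M borel)"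
      using measurable_compose[OF upd f] by (simp add: case_prod_unfold)
    then show ?thesis
      unfolding g_def by (intro lborel.borel_measurable_nn_integral) simp
  qed
  have T [measurable]: "(\<lambda>z. \<lambda>t\<in>{..<Suc n}. c t + z t) \<in>
      Pi\<^sub>M {..<Suc n} (\<lambda>_. borel) \<rightarrow>\<^sub>M Pi\<^sub>M {..<Suc n} (\<lambda>_. borel)"
    by (intro measurable_restrict) auto
  have eq: "(\<lambda>t\<in>{..<Suc n}. c t + (z(n := y)) t) = (?T z)(n := c n + y)" for z y
    by (auto simp: fun_eq_iff less_Suc_eq)
  have fTm: "(\<lambda>z. f (\<lambda>t\<in>{..<Suc n}. c t + z t)) \<in>
      borel_measurable (Pi\<^sub>M (insert n {..<n}) (\<lambda>_. complex_normal))"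
  proof -
    have "sets (Pi\<^sub>M (insert n {..<n}) (\<lambda>_. complex_normal)) = sets (Pi\<^sub>M {..<Suc n} (\<lambda>_. borel))"
      by (intro sets_PiM_cong) auto
    then show ?thesis
      using measurable_compose[OF T f] measurable_cong_sets by blast
  qed
  have fm': "f \<in> borel_measurable (Pi\<^sub>M (insert n {..<n}) (\<lambda>_. lborel))"
    using f sets_leb[of "Suc n"] unfolding lessThan_Suc using measurable_cong_sets by blast
  have "(\<integral>\<^sup>+z. f (\<lambda>t\<in>{..<Suc n}. c t + z t) \<partial>noise (Suc n))
      = (\<integral>\<^sup>+z. \<integral>\<^sup>+y. f (\<lambda>t\<in>{..<Suc n}. c t + (z(n := y)) t) \<partial>complex_normal \<partial>noise n)"
    using noise_prod.product_nn_integral_insert[of "{..<n}" n "\<lambda>z. f (\<lambda>t\<in>{..<Suc n}. c t + z t)", OF _ _ fTm]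
    unfolding noise_def lessThan_Suc by auto
  also have "\<dots> = (\<integral>\<^sup>+z. \<integral>\<^sup>+y. f ((?T z)(n := c n + y)) \<partial>complex_normal \<partial>noise n)"
    by (simp only: eq)
  also have "\<dots> \<le> (\<integral>\<^sup>+z. g (?T z) \<partial>noise n)"
    unfolding g_def
    by (intro nn_integral_mono nn_integral_translate_complex_normal_le fm) (simp add: space_PiM)
  also have "\<dots> \<le> (\<integral>\<^sup>+z. g z \<partial>leb n)"
    by (rule Suc.IH[OF gm])
  also have "\<dots> = (\<integral>\<^sup>+y. f y \<partial>leb (Suc n))"
    unfolding g_def
    using lborel_prod.product_nn_integral_insert[of "{..<n}" n f, OF _ _ fm'] by (simp add: lessThan_Suc)
  finally show ?case .
qed

text \<open>Exponential Markov bound: on the ball the weight exp(n - sum |y - c|^2 / r) is at least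
  1, and its integral factors into Gaussian integrals of value \<open>pi * r\<close>. The exact
  volume is (pi n r)^n / n!, so only a factor polynomial in n is lost.\<close>

lemma emeasure_leb_ball_le:
  assumes "0 < r"
  shows "emeasure (leb n) {y \<in> space (leb n). (\<Sum>t<n. (norm (y t - c t))\<^sup>2) \<le> real n * r}
    \<le> ennreal ((exp 1 * pi * r) ^ n)"
proof -
  have tr: "(\<integral>\<^sup>+y. ennreal (exp (- ((norm (y - d))\<^sup>2 / r))) \<partial>(lborel :: complex measure)) = ennreal (pi * r)" for d
  proof -
    have "(\<integral>\<^sup>+y. ennreal (exp (- ((norm (y - d))\<^sup>2 / r))) \<partial>(lborel :: complex measure))
      = (\<integral>\<^sup>+y. ennreal (exp (- ((norm (y - d))\<^sup>2 / r))) \<partial>distr lborel borel ((+) d))"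
      by (simp add: lborel_distr_plus)
    also have "\<dots> = ennreal (pi * r)"
      by (subst nn_integral_distr) (auto simp: nn_integral_exp_norm_square[OF assms])
    finally show ?thesis .
  qed
  have *: "indicator {y \<in> space (leb n). (\<Sum>t<n. (norm (y t - c t))\<^sup>2) \<le> real n * r} y
      \<le> ennreal (exp (real n)) * (\<Prod>t<n. ennreal (exp (- ((norm (y t - c t))\<^sup>2 / r))))" for y
  proof (cases "(\<Sum>t<n. (norm (y t - c t))\<^sup>2) \<le> real n * r")
    case True
    have "ennreal (exp (real n)) * (\<Prod>t<n. ennreal (exp (- ((norm (y t - c t))\<^sup>2 / r))))
      = ennreal (exp (real n - (\<Sum>t<n. (norm (y t - c t))\<^sup>2) / r))"
      by (simp add: prod_ennreal ennreal_mult[symmetric] exp_sum[symmetric] exp_add[symmetric]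
          sum_negf sum_divide_distrib)
    moreover have "1 \<le> exp (real n - (\<Sum>t<n. (norm (y t - c t))\<^sup>2) / r)"
      using True assms by (simp add: field_simps)
    ultimately show ?thesis
      using ennreal_leI[of 1] by (auto simp: indicator_def)
  qed simp
  have "emeasure (leb n) {y \<in> space (leb n). (\<Sum>t<n. (norm (y t - c t))\<^sup>2) \<le> real n * r}
    \<le> (\<integral>\<^sup>+y. ennreal (exp (real n)) * (\<Prod>t<n. ennreal (exp (- ((norm (y t - c t))\<^sup>2 / r)))) \<partial>leb n)"
    by (subst nn_integral_indicator[symmetric], measurable) (rule nn_integral_mono, rule *)
  also have "\<dots> = ennreal (exp (real n)) * ennreal (pi * r) ^ n"
    by (subst nn_integral_cmult; (subst lborel_prod.product_nn_integral_prod)?) (auto simp: tr)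
  also have "\<dots> = ennreal ((exp 1 * pi * r) ^ n)"
    using assms
    by (simp add: ennreal_power ennreal_mult[symmetric] power_mult_distrib mult.assoc exp_of_nat_mult[symmetric])
  finally show ?thesis .
qed

text \<open>Chernoff bound with exponent 1/2. The energy per symbol has mean 1 and the threshold is
  4, which leaves the factor 2 exp(-2) < 1 for each symbol.\<close>

lemma noise_tail:
  "\<P>(z in noise n. 4 * real n < (\<Sum>t<n. (norm (z t))\<^sup>2)) \<le> (2 / exp 2) ^ n"
proof -
  interpret prob_space "noise n" by (rule prob_space_noise)
  let ?A = "{z \<in> space (noise n). 4 * real n < (\<Sum>t<n. (norm (z t))\<^sup>2)}"
  have A [measurable]: "?A \<in> sets (noise n)" by measurable
  have *: "indicator ?A z \<le> ennreal (exp (- 2 * real n)) * (\<Prod>t<n. ennreal (exp ((norm (z t))\<^sup>2 / 2)))" for z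
  proof (cases "4 * real n < (\<Sum>t<n. (norm (z t))\<^sup>2)")
    case True
    have "ennreal (exp (- 2 * real n)) * (\<Prod>t<n. ennreal (exp ((norm (z t))\<^sup>2 / 2)))
      = ennreal (exp ((\<Sum>t<n. (norm (z t))\<^sup>2) / 2 - 2 * real n))"
      by (simp add: prod_ennreal ennreal_mult[symmetric] exp_sum[symmetric] exp_add[symmetric]
          sum_divide_distrib)
    moreover have "1 \<le> exp ((\<Sum>t<n. (norm (z t))\<^sup>2) / 2 - 2 * real n)"
      using True by simp
    ultimately show ?thesis
      using ennreal_leI[of 1] by (auto simp: indicator_def)
  qed simp
  have "emeasure (noise n) ?A
    \<le> (\<integral>\<^sup>+z. ennreal (exp (- 2 * real n)) * (\<Prod>t<n. ennreal (exp ((norm (z t))\<^sup>2 / 2))) \<partial>noise n)"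
    by (subst nn_integral_indicator[symmetric], rule A) (rule nn_integral_mono, rule *)
  also have "\<dots> = ennreal (exp (- 2 * real n)) * 2 ^ n"
    unfolding noise_def
    by (subst nn_integral_cmult; (subst noise_prod.product_nn_integral_prod)?)
       (auto simp: nn_integral_complex_normal_exp_half)
  also have "\<dots> = ennreal (exp (- 2 * real n)) * ennreal (2 ^ n)"
    by (simp add: ennreal_power[symmetric])
  also have "\<dots> = ennreal ((2 / exp 2) ^ n)"
    by (simp add: ennreal_mult[symmetric] power_divide exp_of_nat2_mult[symmetric] exp_minus field_simps)
  finally show ?thesis
    by (simp add: emeasure_eq_measure)
qed

subsection \<open>Lattice packings and minimum distance decoding\<close>

text \<open>Two geometric series, one on either side of \<open>c\<close>. As \<open>c\<close> may
  lie outside the range of summation, the sum is first extended to \<open>{..<c+q}\<close>.\<close>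

lemma sum_half_power_dist_le: "(\<Sum>k<q. (1/2) ^ nat \<bar>int k - int c\<bar>) \<le> (4::real)"
proof -
  have g: "(\<Sum>k<m. (1/2) ^ k) \<le> (2::real)" for m
    by (subst sum_gp_strict) auto
  have "(\<Sum>k<q. (1/2) ^ nat \<bar>int k - int c\<bar>) \<le> (\<Sum>k\<in>{..<c} \<union> {c..<c+q}. (1/2::real) ^ nat \<bar>int k - int c\<bar>)"
    by (intro sum_mono2) auto
  also have "\<dots> = (\<Sum>k<c. (1/2) ^ nat \<bar>int k - int c\<bar>) + (\<Sum>k\<in>{c..<c+q}. (1/2) ^ nat \<bar>int k - int c\<bar>)"
    by (intro sum.union_disjoint) auto
  also have "(\<Sum>k<c. (1/2::real) ^ nat \<bar>int k - int c\<bar>) = (\<Sum>k<c. (1/2) * (1/2) ^ k)"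
  proof (rule sum.reindex_bij_witness[of _ "\<lambda>k. c - Suc k" "\<lambda>k. c - Suc k"])
    fix k assume "k \<in> {..<c}"
    then have "nat \<bar>int k - int c\<bar> = Suc (c - Suc k)" by auto
    then show "(1/2::real) * (1/2) ^ (c - Suc k) = (1/2) ^ nat \<bar>int k - int c\<bar>" by simp
  qed auto
  also have "(\<Sum>k\<in>{c..<c+q}. (1/2::real) ^ nat \<bar>int k - int c\<bar>) = (\<Sum>k<q. (1/2) ^ k)"
  proof (rule sum.reindex_bij_witness[of _ "\<lambda>k. c + k" "\<lambda>k. k - c"])
    fix k assume "k \<in> {c..<c+q}"
    then have "nat \<bar>int k - int c\<bar> = k - c" by auto
    then show "(1/2::real) ^ (k - c) = (1/2) ^ nat \<bar>int k - int c\<bar>" by (simp only:)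
  qed auto
  also have "(\<Sum>k<c. (1/2::real) * (1/2) ^ k) + (\<Sum>k<q. (1/2) ^ k) \<le> 4"
    unfolding sum_distrib_left[symmetric] using g[of c] g[of q] by linarith
  finally show ?thesis .
qed

text \<open>The discrete counterpart of \<open>emeasure_leb_ball_le\<close>: a Gaussian weight
  replaces the indicator, and its sum factors over the coordinates. The bound does not depend on
  \<open>q\<close>, so that a packing of the cube loses only a constant factor per
  coordinate.\<close>

lemma card_lattice_ball_le:
  fixes c :: "nat \<Rightarrow> nat"
  shows "real (card {x \<in> Pi\<^sub>E {..<n} (\<lambda>_. {..<q}). (\<Sum>t<n. (real (x t) - real (c t))\<^sup>2) \<le> real n * r})
    \<le> (4 * exp r) ^ n"
proof -
  let ?X = "Pi\<^sub>E {..<n} (\<lambda>_. {..<q})"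
  let ?B = "{x \<in> ?X. (\<Sum>t<n. (real (x t) - real (c t))\<^sup>2) \<le> real n * r}"
  have fin: "finite ?X" by (intro finite_PiE) auto
  have e: "exp (- (real k - real d)\<^sup>2) \<le> (1/2) ^ nat \<bar>int k - int d\<bar>" for k d
  proof -
    define u where "u = nat \<bar>int k - int d\<bar>"
    have u: "(real k - real d)\<^sup>2 = (real u)\<^sup>2"
      unfolding u_def by (simp add: of_nat_nat)
    \<comment> \<open>A natural number is at most its square, so that a geometric weight dominates
      the Gaussian weight on integers.\<close>
    have "real u \<le> (real u)\<^sup>2"
      by (simp add: power2_eq_square flip: of_nat_mult)
    then have "exp (- (real k - real d)\<^sup>2) \<le> exp (- real u)"
      by (simp add: u)
    also have "\<dots> = (exp (- 1)) ^ u"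
      by (simp add: exp_of_nat_mult[symmetric])
    also have "\<dots> \<le> (1/2) ^ u"
      using exp_ge_add_one_self[of "1::real"] by (intro power_mono) (auto simp: exp_minus field_simps)
    finally show ?thesis by (simp add: u_def)
  qed
  have "real (card ?B) = (\<Sum>x\<in>?B. 1)" by simp
  also have "\<dots> \<le> (\<Sum>x\<in>?B. exp (real n * r) * (\<Prod>t<n. exp (- (real (x t) - real (c t))\<^sup>2)))"
  proof (intro sum_mono)
    fix x assume "x \<in> ?B"
    then have "0 \<le> real n * r + (\<Sum>t<n. - (real (x t) - real (c t))\<^sup>2)"
      by (simp add: sum_negf)
    then show "1 \<le> exp (real n * r) * (\<Prod>t<n. exp (- (real (x t) - real (c t))\<^sup>2))"
      by (simp only: exp_sum[symmetric, OF finite_lessThan] exp_add[symmetric] one_le_exp_iff)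
  qed
  also have "\<dots> \<le> (\<Sum>x\<in>?X. exp (real n * r) * (\<Prod>t<n. exp (- (real (x t) - real (c t))\<^sup>2)))"
    by (rule sum_mono2[OF fin]) (blast, intro mult_nonneg_nonneg prod_nonneg exp_ge_zero)
  also have "\<dots> = exp (real n * r) * (\<Prod>t<n. \<Sum>k<q. exp (- (real k - real (c t))\<^sup>2))"
    by (subst prod_sum_PiE) (auto simp: sum_distrib_left)
  also have "\<dots> \<le> exp (real n * r) * (\<Prod>t<n. 4)"
  proof (intro mult_left_mono prod_mono conjI)
    show "(\<Sum>k<q. exp (- (real k - real (c t))\<^sup>2)) \<le> 4" for t
      by (rule order.trans[OF sum_mono sum_half_power_dist_le]) (rule e)
  qed (auto intro!: sum_nonneg)
  also have "\<dots> = (4 * exp r) ^ n"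
    by (simp only: power_mult_distrib exp_of_nat_mult prod_constant card_lessThan mult.commute[of "exp r ^ n"])
  finally show ?thesis .
qed

text \<open>Gilbert--Varshamov: the balls around the points of a maximal packing cover the cube.\<close>

lemma lattice_packing_exists:
  fixes r :: real
  assumes "0 \<le> r"
  obtains m :: nat and c :: "nat \<Rightarrow> nat \<Rightarrow> nat" where
    "\<And>i t. i < m \<Longrightarrow> t < n \<Longrightarrow> c i t < q"
    "\<And>i j. i < m \<Longrightarrow> j < m \<Longrightarrow> i \<noteq> j \<Longrightarrow> real n * r < (\<Sum>t<n. (real (c i t) - real (c j t))\<^sup>2)"
    "real q ^ n \<le> real m * (4 * exp r) ^ n"
proof -
  let ?X = "Pi\<^sub>E {..<n} (\<lambda>_. {..<q})"
  let ?d = "\<lambda>x y :: nat \<Rightarrow> nat. \<Sum>t<n. (real (x t) - real (y t))\<^sup>2"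
  define packing where "packing S \<longleftrightarrow> S \<subseteq> ?X \<and> (\<forall>x\<in>S. \<forall>y\<in>S. x \<noteq> y \<longrightarrow> real n * r < ?d x y)" for S
  have fin: "finite ?X" by (intro finite_PiE) auto
  have "packing {}" by (simp add: packing_def)
  moreover have "\<forall>S. packing S \<longrightarrow> card S < Suc (card ?X)"
    using fin by (auto simp: packing_def less_Suc_eq_le intro: card_mono)
  ultimately obtain S where S: "packing S" and max: "\<And>S'. packing S' \<Longrightarrow> card S' \<le> card S"
    using ex_has_greatest_nat[of packing "{}" card "Suc (card ?X)"] by (auto simp: less_imp_le)
  have SX: "S \<subseteq> ?X" using S by (simp add: packing_def)
  have finS: "finite S" using SX fin finite_subset by blast
  have cover: "?X \<subseteq> (\<Union>y\<in>S. {x \<in> ?X. ?d x y \<le> real n * r})"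
  proof
    fix x assume x: "x \<in> ?X"
    show "x \<in> (\<Union>y\<in>S. {x \<in> ?X. ?d x y \<le> real n * r})"
    proof (rule ccontr)
      assume "\<not> ?thesis"
      then have far: "real n * r < ?d x y" if "y \<in> S" for y
        using that x by force
      have "x \<notin> S"
      proof
        assume "x \<in> S"
        then have "real n * r < 0" using far[of x] by simp
        then show False using mult_nonneg_nonneg[of "real n" r] assms by linarith
      qed
      moreover have "packing (insert x S)"
        using S x far by (auto simp: packing_def power2_commute)
      ultimately show False
        using max[of "insert x S"] finS by simp
    qed
  qed
  have "real q ^ n = real (card ?X)"
    by (simp add: card_PiE)
  also have "\<dots> \<le> real (card (\<Union>y\<in>S. {x \<in> ?X. ?d x y \<le> real n * r}))"
    using finS fin by (intro of_nat_mono card_mono cover) auto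
  also have "\<dots> \<le> (\<Sum>y\<in>S. real (card {x \<in> ?X. ?d x y \<le> real n * r}))"
    using card_UN_le[OF finS] by (simp flip: of_nat_sum)
  also have "\<dots> \<le> (\<Sum>y\<in>S. (4 * exp r) ^ n)"
    by (intro sum_mono card_lattice_ball_le)
  finally have size: "real q ^ n \<le> real (card S) * (4 * exp r) ^ n" by simp
  obtain c where c: "bij_betw c {..<card S} S"
    using ex_bij_betw_nat_finite[OF finS] by (auto simp: lessThan_atLeast0)
  show thesis
  proof (rule that[of "card S" c])
    show "c i t < q" if "i < card S" "t < n" for i t
      using SX bij_betwE[OF c] that by (auto simp: PiE_iff subset_eq)
    show "real n * r < ?d (c i) (c j)" if "i < card S" "j < card S" "i \<noteq> j" for i j
    proof -
      have "c i \<in> S" "c j \<in> S" "c i \<noteq> c j"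
        using bij_betwE[OF c] that inj_onD[OF bij_betw_imp_inj_on[OF c], of i j] by auto
      then show ?thesis
        using S by (simp add: packing_def)
    qed
  qed (rule size)
qed

text \<open>A bounded-distance decoder. \<open>LEAST\<close> makes it total: if no codeword is in
  range, the value is unspecified, and such outputs may simply count as errors.\<close>

definition ball_decode ::
  "nat \<Rightarrow> nat \<Rightarrow> real \<Rightarrow> (nat \<Rightarrow> nat \<Rightarrow> nat) \<Rightarrow> (nat \<Rightarrow> real) \<Rightarrow> nat" where
  "ball_decode n m \<delta> c v = (LEAST i. i < m \<and> (\<Sum>t<n. (v t - real (c i t))\<^sup>2) \<le> real n * \<delta>)"

text \<open>Balls of squared radius n \<delta> around codewords at squared distance more than 4 n
  \<delta> are disjoint, by (a - b)^2 <= 2 (x - a)^2 + 2 (x - b)^2. This is the origin of the factor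
  4 in the separation.\<close>

lemma ball_decode_eq:
  assumes sep: "\<And>i j. i < m \<Longrightarrow> j < m \<Longrightarrow> i \<noteq> j \<Longrightarrow>
      real n * (4 * \<delta>) < (\<Sum>t<n. (real (c i t) - real (c j t))\<^sup>2)"
    and i: "i < m" "(\<Sum>t<n. (v t - real (c i t))\<^sup>2) \<le> real n * \<delta>"
  shows "ball_decode n m \<delta> c v = i"
  unfolding ball_decode_def
proof (rule Least_equality)
  show "i < m \<and> (\<Sum>t<n. (v t - real (c i t))\<^sup>2) \<le> real n * \<delta>" using i by simp
  fix j assume j: "j < m \<and> (\<Sum>t<n. (v t - real (c j t))\<^sup>2) \<le> real n * \<delta>"
  have "(a - b)\<^sup>2 \<le> 2 * (x - a)\<^sup>2 + 2 * (x - b)\<^sup>2" for a b x :: real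
    using sum_squares_bound[of "x - a" "b - x"] by (simp add: power2_eq_square algebra_simps)
  then have "(\<Sum>t<n. (real (c i t) - real (c j t))\<^sup>2)
    \<le> (\<Sum>t<n. 2 * (v t - real (c i t))\<^sup>2 + 2 * (v t - real (c j t))\<^sup>2)"
    by (intro sum_mono)
  also have "\<dots> \<le> 2 * (real n * \<delta>) + 2 * (real n * \<delta>)"
    unfolding sum.distrib sum_distrib_left[symmetric]
    using i j by (intro add_mono mult_left_mono) auto
  finally show "i \<le> j"
    using sep[of i j] i j by (cases "i = j") (auto simp: algebra_simps)
qed

lemma measurable_ball_decode [measurable]:
  assumes [measurable]: "\<And>t. t < n \<Longrightarrow> (\<lambda>y. v y t) \<in> borel_measurable M"
  shows "(\<lambda>y. ball_decode n m \<delta> c (v y)) \<in> M \<rightarrow>\<^sub>M count_space UNIV"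
proof -
  have "(\<lambda>y. \<Sum>t<n. (v y t - real (c i t))\<^sup>2) \<in> borel_measurable M" for i
    by (intro borel_measurable_sum) auto
  note this [measurable]
  show ?thesis
    unfolding ball_decode_def by measurable
qed

subsection \<open>Aligned real streams\<close>

text \<open>The coefficient \<open>s\<close> of \<open>y = s p + i p'\<close> with real \<open>s\<close> and \<open>i\<close>.\<close>

definition stream_coeff :: "complex \<Rightarrow> complex \<Rightarrow> complex \<Rightarrow> real" where
  "stream_coeff p p' y = Im (y * cnj p') / Im (p * cnj p')"

lemma measurable_stream_coeff [measurable]: "stream_coeff p p' \<in> borel_measurable borel"
  unfolding stream_coeff_def divide_inverse
  by (intro borel_measurable_continuous_onI continuous_intros)

text \<open>Multiplication by \<open>cnj p'\<close> makes the interfering term real, whatever its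
  real coefficient, so the imaginary part does not see it. What remains is the noise, amplified by
  at most |p'| / |Im (p cnj p')|.\<close>

lemma stream_coeff_error_le:
  assumes "Im (p * cnj p') \<noteq> 0"
  shows "(stream_coeff p p' (of_real s * p + of_real i * p' + z) - s)\<^sup>2
    \<le> (norm p' / Im (p * cnj p'))\<^sup>2 * (norm z)\<^sup>2"
proof -
  let ?D = "Im (p * cnj p')"
  have "Im ((of_real s * p + of_real i * p' + z) * cnj p') = s * ?D + Im (z * cnj p')"
    by (simp add: algebra_simps)
  then have "stream_coeff p p' (of_real s * p + of_real i * p' + z) - s = Im (z * cnj p') / ?D"
    unfolding stream_coeff_def using assms by (simp add: divide_simps del: times_complex.simps)
  then have "(stream_coeff p p' (of_real s * p + of_real i * p' + z) - s)\<^sup>2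
      = (Im (z * cnj p'))\<^sup>2 / ?D\<^sup>2"
    by (simp only: power_divide)
  also have "\<dots> \<le> (norm (z * cnj p'))\<^sup>2 / ?D\<^sup>2"
    using abs_Im_le_cmod[of "z * cnj p'"]
    by (intro divide_right_mono) (simp_all only: abs_le_square_iff[symmetric] abs_norm_cancel zero_le_power2)
  also have "\<dots> = (norm p' / ?D)\<^sup>2 * (norm z)\<^sup>2"
    by (simp only: norm_mult complex_mod_cnj power_divide power_mult_distrib times_divide_eq_left times_divide_eq_right mult.commute)
  finally show ?thesis .
qed

text \<open>The interference coefficients \<open>s\<close> are real but otherwise arbitrary, and
  they are not decoded. Noise energy 4 n, once amplified by the projection, stays within the
  decoding radius n \<delta>.\<close>

lemma ball_decode_stream:
  assumes sep: "\<And>i j. i < m \<Longrightarrow> j < m \<Longrightarrow> i \<noteq> j \<Longrightarrow>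
      real n * (4 * \<delta>) < (\<Sum>t<n. (real (c i t) - real (c j t))\<^sup>2)"
    and i: "i < m"
    and y: "\<And>t. t < n \<Longrightarrow> y t = of_real (real (c i t)) * p + of_real (s t) * p' + z t"
    and p: "Im (p * cnj p') \<noteq> 0" "4 * (norm p' / Im (p * cnj p'))\<^sup>2 \<le> \<delta>"
    and z: "(\<Sum>t<n. (norm (z t))\<^sup>2) \<le> 4 * real n"
  shows "ball_decode n m \<delta> c (\<lambda>t. stream_coeff p p' (y t)) = i"
proof (rule ball_decode_eq[OF sep i])
  have "(\<Sum>t<n. (stream_coeff p p' (y t) - real (c i t))\<^sup>2)
      \<le> (\<Sum>t<n. (norm p' / Im (p * cnj p'))\<^sup>2 * (norm (z t))\<^sup>2)"
    using stream_coeff_error_le[OF p(1)] by (intro sum_mono) (simp only: y lessThan_iff)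
  also have "\<dots> = (norm p' / Im (p * cnj p'))\<^sup>2 * (\<Sum>t<n. (norm (z t))\<^sup>2)"
    by (simp only: sum_distrib_left)
  also have "\<dots> \<le> (norm p' / Im (p * cnj p'))\<^sup>2 * (4 * real n)"
    using z by (intro mult_left_mono) auto
  also have "\<dots> = real n * (4 * (norm p' / Im (p * cnj p'))\<^sup>2)"
    by (simp only: mult.commute mult.left_commute)
  also have "\<dots> \<le> real n * \<delta>"
    using p(2) by (intro mult_left_mono) auto
  finally show "(\<Sum>t<n. (stream_coeff p p' (y t) - real (c i t))\<^sup>2) \<le> real n * \<delta>" .
qed auto

text \<open>If decoding succeeds whenever the noise energy is at most 4 n, every error lies in the
  event of \<open>noise_tail\<close>, and averaging over the messages preserves the bound.\<close>

lemma error_prob_le: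
  assumes "messages K m \<noteq> {}" "finite (messages K m)"
    and dec: "\<And>w z. w \<in> messages K m \<Longrightarrow> z \<in> space (noise n) \<Longrightarrow> (\<Sum>t<n. (norm (z t))\<^sup>2) \<le> 4 * real n \<Longrightarrow>
      g (received n h (x w) z) = w k"
  shows "error_prob K m n x k h g \<le> (2 / exp 2) ^ n"
proof -
  interpret prob_space "noise n" by (rule prob_space_noise)
  have "\<P>(z in noise n. g (received n h (x w) z) \<noteq> w k) \<le> (2 / exp 2) ^ n" if "w \<in> messages K m" for w
  proof -
    have "\<P>(z in noise n. g (received n h (x w) z) \<noteq> w k)
        \<le> \<P>(z in noise n. 4 * real n < (\<Sum>t<n. (norm (z t))\<^sup>2))"
    proof (rule finite_measure_mono)
      show "{z \<in> space (noise n). 4 * real n < (\<Sum>t<n. (norm (z t))\<^sup>2)} \<in> events"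
        by measurable
    qed (use dec[OF that] in force)
    then show ?thesis
      using noise_tail[of n] by linarith
  qed
  then have "(\<Sum>w\<in>messages K m. \<P>(z in noise n. g (received n h (x w) z) \<noteq> w k))
      \<le> (\<Sum>w\<in>messages K m. (2 / exp 2) ^ n)"
    by (intro sum_mono)
  then show ?thesis
    using assms(1,2) unfolding error_prob_def
    by (simp add: divide_le_eq card_gt_0_iff mult.commute del: times_divide_eq_left)
qed

section \<open>The code with three real streams for two users\<close>

lemma row_times_2: "row_times h x = h $ 1 * x $ 1 + h $ 2 * x $ (2 :: 2)"
  by (simp add: row_times_def sum_2)

lemma row_times_add: "row_times h (x + y) = row_times h x + row_times h y"
  by (simp add: row_times_def distrib_left sum.distrib)

lemma row_times_scaleR: "row_times h (a *\<^sub>R x) = of_real a * row_times h x"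
  by (simp add: row_times_def scaleR_sum_right flip: scaleR_conv_of_real)

lemma states_2:
  assumes "J 1 = 1" "J 2 = 3"
  shows "states 2 J = {(1, 1), (2, 1), (2, 2), (2, 3)}"
proof -
  have i: "{1..1::nat} = {1}" "{1..2::nat} = {1, 2}" "{1..3::nat} = {1, 2, 3}" by auto
  have "states 2 J = {1} \<times> {1..J 1} \<union> {2} \<times> {1..J 2}"
    unfolding states_def i(2) by blast
  also have "\<dots> = {(1, 1), (2, 1), (2, 2), (2, 3)}"
    unfolding assms i by blast
  finally show ?thesis .
qed

lemma messages_2: "w \<in> messages 2 m \<Longrightarrow> w 1 < m 1 \<and> w 2 < m 2"
  by (auto simp: messages_def PiE_iff)

lemma finite_messages: "finite (messages K m)"
  unfolding messages_def by (intro finite_PiE) auto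

lemma card_messages_2: "card (messages 2 m) = m 1 * m 2"
proof -
  have "{1..2::nat} = {1, 2}" by auto
  then show ?thesis
    by (simp add: messages_def card_PiE)
qed

text \<open>The alignment scheme for abstract beams: \<open>v3\<close> is invisible to user 1, where
  \<open>v1\<close> and \<open>v2\<close> are independent over the reals; at state \<open>j\<close>
  of user 2 both \<open>v1\<close> and \<open>v2\<close> fall on the real line through
  \<open>d j\<close>, and \<open>v3\<close> lies off it. Each wanted stream is thus a real
  coordinate of the complex output and carries log q - O(1) bits.\<close>

lemma achievable_real_streams:
  fixes h :: "nat \<times> nat \<Rightarrow> complex ^ 2" and v1 v2 v3 :: "complex ^ 2"
    and a b :: "nat \<Rightarrow> real" and e d :: "nat \<Rightarrow> complex"
  assumes J: "J 1 = 1" "J 2 = 3"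
    and u1: "row_times (h (1, 1)) v3 = 0"
      "Im (row_times (h (1, 1)) v1 * cnj (row_times (h (1, 1)) v2)) \<noteq> 0"
    and u2: "\<And>j. j \<in> {1, 2, 3} \<Longrightarrow> row_times (h (2, j)) v1 = of_real (a j) * d j"
      "\<And>j. j \<in> {1, 2, 3} \<Longrightarrow> row_times (h (2, j)) v2 = of_real (b j) * d j"
      "\<And>j. j \<in> {1, 2, 3} \<Longrightarrow> Im (row_times (h (2, j)) v3 * cnj (d j)) \<noteq> 0"
  obtains C where "1 \<le> C"
    "\<And>P q. C \<le> real q \<Longrightarrow> (norm v1 + norm v2 + norm v3)\<^sup>2 * (real q)\<^sup>2 \<le> P \<Longrightarrow>
      achievable 2 J h P (\<lambda>k. if k = 1 then 2 * log 2 (real q / C) else log 2 (real q / C))"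
proof -
  let ?p = "row_times (h (1, 1)) v1" and ?p' = "row_times (h (1, 1)) v2"
  let ?e = "\<lambda>j. row_times (h (2, j)) v3"
  let ?g = "\<lambda>p p'. 4 * (norm p' / Im (p * cnj p'))\<^sup>2"
  have u1': "Im (?p' * cnj ?p) \<noteq> 0"
    using u1(2) by (simp add: mult.commute)
  \<comment> \<open>The sum of the five noise amplifications bounds each of them, so that one
    packing serves all streams and all states.\<close>
  define \<delta> where "\<delta> = ?g ?p ?p' + ?g ?p' ?p + (\<Sum>j\<in>{1,2,3}. ?g (?e j) (d j))"
  have g0: "0 \<le> ?g p p'" for p p' by simp
  have s0: "0 \<le> (\<Sum>j\<in>{1,2,3}. ?g (?e j) (d j))" by (intro sum_nonneg g0)
  have \<delta>1: "?g ?p ?p' \<le> \<delta>" and \<delta>2: "?g ?p' ?p \<le> \<delta>" and \<delta>0: "0 \<le> \<delta>"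
    unfolding \<delta>_def using g0[of ?p ?p'] g0[of ?p' ?p] s0 by linarith+
  have \<delta>3: "?g (?e j) (d j) \<le> \<delta>" if "j \<in> {1,2,3}" for j
  proof -
    have "?g (?e j) (d j) \<le> (\<Sum>j\<in>{1,2,3}. ?g (?e j) (d j))"
      by (rule member_le_sum[OF that]) (auto simp: g0)
    then show ?thesis
      unfolding \<delta>_def using g0[of ?p ?p'] g0[of ?p' ?p] by linarith
  qed
  \<comment> \<open>The loss per coordinate of a packing whose squared separation is
    \<open>4 * \<delta>\<close> per coordinate.\<close>
  define C where "C = 4 * exp (4 * \<delta>)"
  have C1: "1 \<le> C" using \<delta>0 exp_ge_add_one_self[of "4 * \<delta>"] unfolding C_def by linarith
  show thesis
  proof (rule that[OF C1])
    fix P :: real and q :: nat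
    assume q: "C \<le> real q" and P: "(norm v1 + norm v2 + norm v3)\<^sup>2 * (real q)\<^sup>2 \<le> P"
    let ?\<rho> = "log 2 (real q / C)"
    have q1: "1 \<le> real q / C" using q C1 by (simp add: field_simps)
    have \<rho>: "2 powr (real n * ?\<rho>) = (real q / C) ^ n" for n
    proof -
      have "2 powr (real n * ?\<rho>) = (2 powr ?\<rho>) powr real n"
        by (simp add: powr_powr mult.commute)
      then show ?thesis
        using q1 by (simp add: powr_realpow)
    qed
    have P0: "0 \<le> P" using P by (rule order.trans[rotated]) simp
    show "achievable 2 J h P (\<lambda>k. if k = 1 then 2 * ?\<rho> else ?\<rho>)"
      unfolding achievable_def
    proof (intro conjI allI impI)
      show "\<forall>k\<in>{1..2}. 0 \<le> (if k = 1 then 2 * ?\<rho> else ?\<rho>)"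
        using q1 by simp
      fix \<epsilon> :: real and n0 :: nat
      assume \<epsilon>: "0 < \<epsilon>"
      have e2: "2 / exp (2::real) < 1"
        using exp_ge_add_one_self[of "2::real"] by simp
      obtain n1 where n1: "(2 / exp 2) ^ n1 < \<epsilon>"
        using real_arch_pow_inv[OF \<epsilon> e2] by blast
      \<comment> \<open>\<open>n1\<close> makes the error tail small, and the 1 keeps the average
        over the block from dividing by 0.\<close>
      define n where "n = max n0 (max 1 n1)"
      have n: "n0 \<le> n" "1 \<le> n" "n1 \<le> n" by (auto simp: n_def)
      have tail: "(2 / exp 2) ^ n \<le> \<epsilon>"
        using power_decreasing[OF n(3), of "2 / exp (2::real)"] e2 n1
        by (meson divide_nonneg_nonneg exp_ge_zero less_eq_real_def order_trans zero_le_numeral)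
      have \<delta>4: "0 \<le> 4 * \<delta>" using \<delta>0 by simp
      obtain m c where c: "\<And>i t. i < m \<Longrightarrow> t < n \<Longrightarrow> c i t < q"
        and sep: "\<And>i j. i < m \<Longrightarrow> j < m \<Longrightarrow> i \<noteq> j \<Longrightarrow>
          real n * (4 * \<delta>) < (\<Sum>t<n. (real (c i t) - real (c j t))\<^sup>2)"
        and size: "real q ^ n \<le> real m * (4 * exp (4 * \<delta>)) ^ n"
        by (rule lattice_packing_exists[OF \<delta>4, where n = n and q = q]) (rule that)
      have mq: "(real q / C) ^ n \<le> real m"
        using size C1 unfolding C_def[symmetric] by (simp add: power_divide divide_le_eq)
      have m0: "0 < m"
      proof (rule ccontr)
        assume "\<not> 0 < m"
        then show False using mq one_le_power[OF q1, of n] by simp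
      qed
      \<comment> \<open>User 1 has \<open>m * m\<close> messages: \<open>w 1 div m\<close> and
        \<open>w 1 mod m\<close> are the codeword indices of its two streams. All three streams use
        the same codebook \<open>c\<close>.\<close>
      define M where "M = (\<lambda>k :: nat. if k = 1 then m * m else m)"
      define x where "x w t = real (c (w 1 div m) t) *\<^sub>R v1 + real (c (w 1 mod m) t) *\<^sub>R v2
          + real (c (w 2) t) *\<^sub>R v3" for w :: "nat \<Rightarrow> nat" and t
      let ?dec = "\<lambda>p p' y. ball_decode n m \<delta> c (\<lambda>t. stream_coeff p p' (y t))"
      define g where "g s y = (if fst s = 1 then ?dec ?p ?p' y * m + ?dec ?p' ?p y
          else ?dec (?e (snd s)) (d (snd s)) y)" for s :: "nat \<times> nat" and y
      have M: "messages 2 M \<noteq> {}"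
        using card_messages_2[of M] m0 by (auto simp: M_def)
      have wlt: "w 1 div m < m" "w 1 mod m < m" "w 2 < m" if "w \<in> messages 2 M" for w
        using messages_2[OF that] m0 by (auto simp: M_def less_mult_imp_div_less)
      have rec: "received n g (x w) z t = of_real (c (w 1 div m) t) * row_times g v1
          + of_real (c (w 1 mod m) t) * row_times g v2 + of_real (c (w 2) t) * row_times g v3 + z t"
        if "t < n" for g w z t
        using that by (simp add: received_def x_def row_times_add row_times_scaleR)
      have [measurable]: "(\<lambda>y. ?dec p p' y) \<in> Pi\<^sub>M {..<n} (\<lambda>_. borel) \<rightarrow>\<^sub>M count_space UNIV" for p p'
        by measurable
      have gm: "g s \<in> Pi\<^sub>M {..<n} (\<lambda>_. borel) \<rightarrow>\<^sub>M count_space UNIV" for s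
        unfolding g_def by measurable
      have dec1: "g (1, 1) (received n (h (1, 1)) (x w) z) = w 1"
        if w: "w \<in> messages 2 M" and z: "(\<Sum>t<n. (norm (z t))\<^sup>2) \<le> 4 * real n" for w z
      proof -
        let ?y = "received n (h (1, 1)) (x w) z"
        have "?dec ?p ?p' ?y = w 1 div m"
        proof (rule ball_decode_stream[OF _ wlt(1)[OF w] _ u1(2) \<delta>1 z, where s = "\<lambda>t. real (c (w 1 mod m) t)"])
          show "real n * (4 * \<delta>) < (\<Sum>t<n. (real (c i t) - real (c j t))\<^sup>2)"
            if "i < m" "j < m" "i \<noteq> j" for i j
            using that by (rule sep)
          show "?y t = of_real (real (c (w 1 div m) t)) * ?p + of_real (real (c (w 1 mod m) t)) * ?p' + z t" if "t < n" for t
            by (simp only: rec[OF that] u1(1) mult_zero_right add_0_right)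
        qed
        moreover have "?dec ?p' ?p ?y = w 1 mod m"
        proof (rule ball_decode_stream[OF _ wlt(2)[OF w] _ u1' \<delta>2 z, where s = "\<lambda>t. real (c (w 1 div m) t)"])
          show "real n * (4 * \<delta>) < (\<Sum>t<n. (real (c i t) - real (c j t))\<^sup>2)"
            if "i < m" "j < m" "i \<noteq> j" for i j
            using that by (rule sep)
          show "?y t = of_real (real (c (w 1 mod m) t)) * ?p' + of_real (real (c (w 1 div m) t)) * ?p + z t" if "t < n" for t
            by (simp only: rec[OF that] u1(1) mult_zero_right add_0_right add_0_left add.commute)
        qed
        ultimately show ?thesis
          by (simp add: g_def)
      qed
      have e1: "error_prob 2 M n x 1 (h (1, 1)) (g (1, 1)) \<le> \<epsilon>"
        by (rule order.trans[OF error_prob_le[OF M finite_messages] tail]) (rule dec1)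
      have dec2: "g (2, j) (received n (h (2, j)) (x w) z) = w 2"
        if j: "j \<in> {1, 2, 3}" and w: "w \<in> messages 2 M"
          and z: "(\<Sum>t<n. (norm (z t))\<^sup>2) \<le> 4 * real n" for j w z
      proof -
        let ?y = "received n (h (2, j)) (x w) z"
        have "?dec (?e j) (d j) ?y = w 2"
        proof (rule ball_decode_stream[OF _ wlt(3)[OF w] _ u2(3)[OF j] \<delta>3[OF j] z, where s = "\<lambda>t. real (c (w 1 div m) t) * a j + real (c (w 1 mod m) t) * b j"])
          show "real n * (4 * \<delta>) < (\<Sum>t<n. (real (c i t) - real (c j' t))\<^sup>2)"
            if "i < m" "j' < m" "i \<noteq> j'" for i j'
            using that by (rule sep)
          show "?y t = of_real (real (c (w 2) t)) * ?e j +
              of_real (real (c (w 1 div m) t) * a j + real (c (w 1 mod m) t) * b j) * d j + z t" if "t < n" for t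
            by (simp only: rec[OF that] u2(1,2)[OF j]) (simp add: algebra_simps)
        qed
        then show ?thesis
          by (simp add: g_def)
      qed
      have e2: "error_prob 2 M n x 2 (h (2, j)) (g (2, j)) \<le> \<epsilon>" if "j \<in> {1, 2, 3}" for j
        by (rule order.trans[OF error_prob_le[OF M finite_messages] tail]) (rule dec2[OF that])
      \<comment> \<open>The power constraint holds at each time and for each message, since all
        codeword entries are below \<open>q\<close>.\<close>
      have pw: "(norm (x w t))\<^sup>2 \<le> P" if w: "w \<in> messages 2 M" and t: "t < n" for w t
      proof -
        have *: "norm (real k *\<^sub>R v) \<le> real q * norm v" if "k < q" for k and v :: "complex ^ 2"
          using that by (simp add: mult_right_mono)
        have "norm (x w t) \<le> real q * norm v1 + real q * norm v2 + real q * norm v3"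
          unfolding x_def by (intro norm_triangle_le add_mono * c wlt w t)
        then have "(norm (x w t))\<^sup>2 \<le> (real q * norm v1 + real q * norm v2 + real q * norm v3)\<^sup>2"
          by (intro power_mono) auto
        also have "\<dots> \<le> P"
          using P by (simp add: power_mult_distrib[symmetric] algebra_simps)
        finally show ?thesis .
      qed
      have "(\<Sum>t<n. (norm (x w t))\<^sup>2) / real n \<le> P" if w: "w \<in> messages 2 M" for w
        using sum_mono[of "{..<n}" "\<lambda>t. (norm (x w t))\<^sup>2" "\<lambda>_. P"] pw[OF w] n(2)
        by (simp add: divide_le_eq mult.commute)
      then have "(\<Sum>w\<in>messages 2 M. (\<Sum>t<n. (norm (x w t))\<^sup>2) / real n) \<le> (\<Sum>w\<in>messages 2 M. P)"
        by (intro sum_mono)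
      then have avg: "avg_power 2 M n x \<le> P"
        unfolding avg_power_def using M finite_messages[of 2 M]
        by (simp add: divide_le_eq card_gt_0_iff mult.commute)
      have rates: "\<forall>k\<in>{1..2}. 2 powr (real n * (if k = 1 then 2 * ?\<rho> else ?\<rho>)) \<le> real (M k)"
      proof
        fix k :: nat
        have le: "2 powr (real n * ?\<rho>) \<le> real m"
          using mq by (simp only: \<rho>)
        have "2 powr (real n * (2 * ?\<rho>)) = 2 powr (real n * ?\<rho> + real n * ?\<rho>)"
          by (rule arg_cong[where f = "(powr) 2"]) (simp only: mult_2 distrib_left)
        also have "\<dots> = (2 powr (real n * ?\<rho>)) * (2 powr (real n * ?\<rho>))"
          by (rule powr_add)
        also have "\<dots> \<le> real m * real m"
          by (intro mult_mono le) simp_all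
        finally show "2 powr (real n * (if k = 1 then 2 * ?\<rho> else ?\<rho>)) \<le> real (M k)"
          using le by (cases "k = 1") (simp_all only: M_def of_nat_mult if_True if_False simp_thms)
      qed
      have dec: "\<forall>(k, j)\<in>states 2 J. g (k, j) \<in> Pi\<^sub>M {..<n} (\<lambda>_. borel) \<rightarrow>\<^sub>M count_space UNIV \<and>
          error_prob 2 M n x k (h (k, j)) (g (k, j)) \<le> \<epsilon>"
      proof clarify
        fix k j assume "(k, j) \<in> states 2 J"
        then consider "k = 1" "j = 1" | "k = 2" "j \<in> {1, 2, 3}"
          unfolding states_2[OF J] by auto
        then show "g (k, j) \<in> Pi\<^sub>M {..<n} (\<lambda>_. borel) \<rightarrow>\<^sub>M count_space UNIV \<and>
            error_prob 2 M n x k (h (k, j)) (g (k, j)) \<le> \<epsilon>"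
        proof cases
          case 1
          show ?thesis unfolding 1 using gm e1 by (rule conjI)
        next
          case 2
          show ?thesis unfolding 2(1) using gm e2[OF 2(2)] by (rule conjI)
        qed
      qed
      show "\<exists>n\<ge>n0. \<exists>m x g. (\<forall>k\<in>{1..2}. 2 powr (real n * (if k = 1 then 2 * ?\<rho> else ?\<rho>)) \<le> real (m k)) \<and>
          avg_power 2 m n x \<le> P \<and>
          (\<forall>(k, j)\<in>states 2 J. g (k, j) \<in> Pi\<^sub>M {..<n} (\<lambda>_. borel) \<rightarrow>\<^sub>M count_space UNIV \<and>
             error_prob 2 m n x k (h (k, j)) (g (k, j)) \<le> \<epsilon>)"
        by (rule exI[of _ n], rule conjI[OF n(1)], rule exI[of _ M], rule exI[of _ x], rule exI[of _ g],
            rule conjI[OF rates conjI[OF avg dec]])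
    qed
  qed
qed

subsection \<open>The cross ratio of the channels\<close>

definition det2 :: "complex ^ 2 \<Rightarrow> complex ^ 2 \<Rightarrow> complex" where
  "det2 g h = g $ 1 * h $ 2 - g $ 2 * h $ 1"

text \<open>A generator of the kernel of \<open>row_times h\<close> when \<open>h\<close> is
  nonzero. No conjugates occur because \<open>row_times\<close> is bilinear.\<close>

definition perp :: "complex ^ 2 \<Rightarrow> complex ^ 2" where
  "perp h = vector [h $ 2, - h $ 1]"

lemma row_times_perp: "row_times g (c *s perp h) = c * det2 g h"
  by (simp add: row_times_2 perp_def det2_def algebra_simps)

lemma det2_self [simp]: "det2 h h = 0"
  by (simp add: det2_def)

lemma det2_swap: "det2 g h = - det2 h g"
  by (simp add: det2_def)

lemma det2_Plucker: "det2 a d * det2 b c = det2 a b * det2 d c - det2 a c * det2 d b"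
  by (simp add: det2_def algebra_simps)

text \<open>
  Non-real cross ratio: the states of the two users, seen as points \<open>h $ 2 / h $ 1\<close> of the Riemann
  sphere, do not lie on a circle.
\<close>

definition nondegenerate :: "(nat \<times> nat \<Rightarrow> complex ^ 2) \<Rightarrow> bool" where
  "nondegenerate h \<longleftrightarrow>
    Im (det2 (h (1, 1)) (h (2, 1)) * det2 (h (2, 3)) (h (2, 2)) *
      cnj (det2 (h (1, 1)) (h (2, 2)) * det2 (h (2, 3)) (h (2, 1)))) \<noteq> 0"

text \<open>If z cnj(w) is not real, then z and w are nonzero and distinct. The Pluecker relation
  turns their difference into the product of the two determinants that do not occur in the cross
  ratio.\<close>

lemma nondegenerate_det2:
  assumes "nondegenerate h"
  shows "det2 (h (1, 1)) (h (2, 1)) \<noteq> 0" "det2 (h (1, 1)) (h (2, 2)) \<noteq> 0"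
    "det2 (h (1, 1)) (h (2, 3)) \<noteq> 0" "det2 (h (2, 1)) (h (2, 2)) \<noteq> 0"
    "det2 (h (2, 3)) (h (2, 1)) \<noteq> 0" "det2 (h (2, 3)) (h (2, 2)) \<noteq> 0"
proof -
  let ?a = "det2 (h (1, 1)) (h (2, 1)) * det2 (h (2, 3)) (h (2, 2))"
  let ?b = "det2 (h (1, 1)) (h (2, 2)) * det2 (h (2, 3)) (h (2, 1))"
  have ab: "Im (?a * cnj ?b) \<noteq> 0"
    using assms unfolding nondegenerate_def .
  have real: "Im (z * cnj z) = 0" for z
    by (simp add: algebra_simps)
  have "?a \<noteq> 0" "?b \<noteq> 0" "?a \<noteq> ?b"
    using ab real[of ?a] by (metis Im_complex_of_real mult_zero_left of_real_0,
        metis complex_cnj_zero mult_zero_right zero_complex.simps(2), metis)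
  moreover have "det2 (h (1, 1)) (h (2, 3)) * det2 (h (2, 1)) (h (2, 2)) = ?a - ?b"
    by (rule det2_Plucker)
  ultimately show "det2 (h (1, 1)) (h (2, 1)) \<noteq> 0" "det2 (h (1, 1)) (h (2, 2)) \<noteq> 0"
    "det2 (h (1, 1)) (h (2, 3)) \<noteq> 0" "det2 (h (2, 1)) (h (2, 2)) \<noteq> 0"
    "det2 (h (2, 3)) (h (2, 1)) \<noteq> 0" "det2 (h (2, 3)) (h (2, 2)) \<noteq> 0"
    by (metis mult_eq_0_iff right_minus_eq)+
qed

text \<open>For \<omega> = 1 + i \<tau> with \<tau> real, the imaginary part of
  \<open>\<omega> * \<kappa> j\<close> is affine in \<tau> and not identically zero, so at most
  three values of \<tau> are bad. This turns the beam of user 2 off the interference line at all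
  three of its states.\<close>

lemma exists_rotation_off_real_line:
  assumes "\<And>j. j \<in> {1, 2, 3 :: nat} \<Longrightarrow> \<kappa> j \<noteq> (0 :: complex)"
  obtains \<omega> :: complex where "\<And>j. j \<in> {1, 2, 3} \<Longrightarrow> Im (\<omega> * \<kappa> j) \<noteq> 0"
proof -
  \<comment> \<open>If \<open>Re (\<kappa> j) = 0\<close>, the quotient is 0 by convention; the
    imaginary part is then a nonzero constant and no \<tau> is bad for this
    \<open>j\<close>.\<close>
  let ?bad = "\<Union>j\<in>{1, 2, 3}. {- Im (\<kappa> j) / Re (\<kappa> j)}"
  have "finite ?bad" by simp
  then obtain \<tau> :: real where \<tau>: "\<tau> \<notin> ?bad"
    using ex_new_if_finite[OF infinite_UNIV_char_0] by blast
  show thesis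
  proof (rule that)
    fix j :: nat assume j: "j \<in> {1, 2, 3}"
    have I: "Im ((1 + \<i> * of_real \<tau>) * \<kappa> j) = Im (\<kappa> j) + \<tau> * Re (\<kappa> j)"
      by (simp add: algebra_simps)
    show "Im ((1 + \<i> * of_real \<tau>) * \<kappa> j) \<noteq> 0"
    proof
      assume "Im ((1 + \<i> * of_real \<tau>) * \<kappa> j) = 0"
      then have z: "Im (\<kappa> j) + \<tau> * Re (\<kappa> j) = 0" using I by simp
      show False
      proof (cases "Re (\<kappa> j) = 0")
        case True
        then show False using z assms[OF j] by (simp add: complex_eq_iff)
      next
        case False
        then have "\<tau> = - Im (\<kappa> j) / Re (\<kappa> j)"
          using z by (simp add: field_simps)
        then show False using \<tau> j by blast
      qed
    qed
  qed
qed

text \<open>The factors \<open>?d32\<close> and \<open>?d31\<close> make the beams of user 1 agree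
  at state 3 of user 2, and at states 1 and 2 one of them vanishes. Hence all real coefficients are
  0 or 1, and the independence required at user 1 is literally \<open>nondegenerate\<close>.\<close>

lemma achievable_three_halves:
  fixes h :: "nat \<times> nat \<Rightarrow> complex ^ 2"
  assumes J: "J 1 = 1" "J 2 = 3" and h: "nondegenerate h"
  obtains C c where "1 \<le> C" "0 \<le> c"
    "\<And>P q. C \<le> real q \<Longrightarrow> c * (real q)\<^sup>2 \<le> P \<Longrightarrow>
      achievable 2 J h P (\<lambda>k. if k = 1 then 2 * log 2 (real q / C) else log 2 (real q / C))"
proof -
  let ?h = "\<lambda>j. h (2, j)"
  let ?d32 = "det2 (?h 3) (?h 2)" and ?d31 = "det2 (?h 3) (?h 1)"
  note nz = nondegenerate_det2[OF h]
  \<comment> \<open>At each state of user 2, the common value of those beams of user 1 that do not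
    vanish there.\<close>
  define d where "d = (\<lambda>j :: nat. if j = 1 then ?d31 * det2 (?h 1) (?h 2)
    else if j = 2 then ?d32 * det2 (?h 2) (?h 1) else ?d32 * ?d31)"
  have sw: "det2 (?h j) (h (1, 1)) \<noteq> 0" if "j \<in> {1, 2, 3}" for j
    using nz(1-3) that det2_swap[of "?h j" "h (1, 1)"] by auto
  have "d j \<noteq> 0" for j
    using nz(4-6) det2_swap[of "?h 2" "?h 1"] by (simp add: d_def)
  then have "det2 (?h j) (h (1, 1)) * cnj (d j) \<noteq> 0" if "j \<in> {1, 2, 3}" for j
    using sw[OF that] by simp
  then obtain \<omega> where \<omega>: "\<And>j. j \<in> {1, 2, 3} \<Longrightarrow> Im (\<omega> * (det2 (?h j) (h (1, 1)) * cnj (d j))) \<noteq> 0"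
    using exists_rotation_off_real_line[of "\<lambda>j. det2 (?h j) (h (1, 1)) * cnj (d j)"] by blast
  let ?v1 = "?d32 *s perp (?h 1)" and ?v2 = "?d31 *s perp (?h 2)" and ?v3 = "\<omega> *s perp (h (1, 1))"
  obtain C where C: "1 \<le> C" "\<And>P q. C \<le> real q \<Longrightarrow> (norm ?v1 + norm ?v2 + norm ?v3)\<^sup>2 * (real q)\<^sup>2 \<le> P \<Longrightarrow>
      achievable 2 J h P (\<lambda>k. if k = 1 then 2 * log 2 (real q / C) else log 2 (real q / C))"
  proof (rule achievable_real_streams[OF J, of h ?v3 ?v1 ?v2
        "\<lambda>j. if j = 1 then 0 else 1" d "\<lambda>j. if j = 2 then 0 else 1"])
    show "row_times (h (1, 1)) ?v3 = 0"
      by (simp only: row_times_perp det2_self mult_zero_right)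
    show "Im (row_times (h (1, 1)) ?v1 * cnj (row_times (h (1, 1)) ?v2)) \<noteq> 0"
      using h unfolding nondegenerate_def row_times_perp by (simp only: mult.commute not_False_eq_True)
    show "row_times (?h j) ?v1 = of_real (if j = 1 then 0 else 1) * d j" if "j \<in> {1, 2, 3}" for j
      using that unfolding row_times_perp d_def by auto
    show "row_times (?h j) ?v2 = of_real (if j = 2 then 0 else 1) * d j" if "j \<in> {1, 2, 3}" for j
      using that unfolding row_times_perp d_def by auto
    show "Im (row_times (?h j) ?v3 * cnj (d j)) \<noteq> 0" if "j \<in> {1, 2, 3}" for j
      using \<omega>[OF that] unfolding row_times_perp by (simp only: mult.assoc simp_thms)
  qed (rule that)
  show thesis
    by (rule that[OF C(1) _ C(2)]) simp_all
qed

text \<open>With q about sqrt(P / (c + 1)), each of the three streams carries 1/2 log P - O(1)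
  bits.\<close>

lemma sum_capacity_lower_bound:
  fixes h :: "nat \<times> nat \<Rightarrow> complex ^ 2"
  assumes J: "J 1 = 1" "J 2 = 3" and h: "nondegenerate h"
  shows "\<exists>K. eventually (\<lambda>P. ereal (3 / 2 * log 2 P - K) \<le> sum_capacity 2 J h P) at_top"
proof -
  obtain C c where C: "1 \<le> C" and c: "0 \<le> c"
    and ach: "\<And>P q. C \<le> real q \<Longrightarrow> c * (real q)\<^sup>2 \<le> P \<Longrightarrow>
      achievable 2 J h P (\<lambda>k. if k = 1 then 2 * log 2 (real q / C) else log 2 (real q / C))"
    using achievable_three_halves[OF J h] by blast
  define K where "K = 3 / 2 * log 2 (c + 1) + 3 * log 2 (2 * C)"
  \<comment> \<open>The threshold on \<open>P\<close> gives s >= 2 C >= 2, so rounding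
    \<open>s\<close> down to \<open>q\<close> costs at most a factor 2 and leaves q >= C. Dividing
    by \<open>c + 1\<close> is safe even for c = 0.\<close>
  have "ereal (3 / 2 * log 2 P - K) \<le> sum_capacity 2 J h P" if P: "(c + 1) * (2 * C)\<^sup>2 \<le> P" for P
  proof -
    define s where "s = sqrt (P / (c + 1))"
    define q where "q = nat \<lfloor>s\<rfloor>"
    have "(2 * C)\<^sup>2 \<le> P / (c + 1)"
      using P c by (simp add: field_simps)
    then have s: "2 * C \<le> s"
      unfolding s_def by (rule real_le_rsqrt)
    have "0 < (c + 1) * (2 * C)\<^sup>2"
      using C c by (intro mult_pos_pos) auto
    then have P0: "0 < P" using P by linarith
    have qs: "real q \<le> s" "s - 1 \<le> real q"
      using s C by (auto simp: q_def of_nat_nat floor_le_iff)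
    have q: "s / 2 \<le> real q" "C \<le> real q"
      using qs s C by linarith+
    have "c * (real q)\<^sup>2 \<le> (c + 1) * s\<^sup>2"
      using c qs by (intro mult_mono power_mono) auto
    also have "\<dots> = P"
      using P0 c by (simp add: s_def)
    finally have a: "achievable 2 J h P (\<lambda>k. if k = 1 then 2 * log 2 (real q / C) else log 2 (real q / C))"
      by (intro ach q(2))
    have s0: "0 < s" using s C by linarith
    have ls: "log 2 s = (log 2 P - log 2 (c + 1)) / 2"
      using P0 c by (simp add: s_def powr_half_sqrt[symmetric] log_powr log_divide)
    have "log 2 (s / (2 * C)) = log 2 s - log 2 (2 * C)"
      using s0 C by (subst log_divide) auto
    then have "3 / 2 * log 2 P - K = 3 * log 2 (s / (2 * C))"
      unfolding ls K_def by (simp add: field_simps)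
    also have "\<dots> \<le> 3 * log 2 (real q / C)"
      using q(1) s0 C by (intro mult_left_mono) (auto intro!: log_mono divide_right_mono simp: field_simps)
    also have "\<dots> = (\<Sum>k = 1..2::nat. if k = 1 then 2 * log 2 (real q / C) else log 2 (real q / C))"
    proof -
      have "{1..2::nat} = {1, 2}" by auto
      then show ?thesis by simp
    qed
    finally show ?thesis
      unfolding sum_capacity_def using a
      by (intro SUP_upper2[where i = "\<lambda>k. if k = 1 then 2 * log 2 (real q / C) else log 2 (real q / C)"])
         (simp_all only: mem_Collect_eq ereal_less_eq)
  qed
  then show ?thesis
    unfolding eventually_at_top_linorder by blast
qed

subsection \<open>Decoding regions and their volumes\<close>

text \<open>Two averaging arguments. First a message \<open>j\<close> of user 2 is chosen for which
  both volumes \<open>A\<close>, \<open>B\<close> and the mean penalty over the messages of user 1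
  are small at once; then Markov's inequality keeps at least half of the messages of user 1. The
  penalty combines the error probabilities \<open>e1\<close>, \<open>e2\<close>, \<open>e3\<close>
  and the power \<open>p\<close>.\<close>

lemma exists_good_message:
  fixes e1 e2 e3 p :: "nat \<Rightarrow> nat \<Rightarrow> real" and A B :: "nat \<Rightarrow> real"
  assumes m: "0 < m1" "0 < m2" and P: "0 < P" and V: "0 < V"
    and nonneg: "\<And>i j. 0 \<le> e1 i j" "\<And>i j. 0 \<le> e2 i j" "\<And>i j. 0 \<le> e3 i j" "\<And>i j. 0 \<le> p i j"
      "\<And>j. 0 \<le> A j" "\<And>j. 0 \<le> B j"
    and e: "(\<Sum>i<m1. \<Sum>j<m2. e1 i j) \<le> real m1 * real m2 / 100"
      "(\<Sum>i<m1. \<Sum>j<m2. e2 i j) \<le> real m1 * real m2 / 100"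
      "(\<Sum>i<m1. \<Sum>j<m2. e3 i j) \<le> real m1 * real m2 / 100"
    and p: "(\<Sum>i<m1. \<Sum>j<m2. p i j) \<le> P * (real m1 * real m2)"
    and AB: "(\<Sum>j<m2. A j) \<le> V" "(\<Sum>j<m2. B j) \<le> V"
  obtains j G where "j < m2" "A j \<le> 6 * V / real m2" "B j \<le> 6 * V / real m2"
    "G \<subseteq> {..<m1}" "real m1 \<le> 2 * real (card G)"
    "\<And>i. i \<in> G \<Longrightarrow> e1 i j \<le> 1 / 4 \<and> e2 i j \<le> 1 / 4 \<and> e3 i j \<le> 1 / 4 \<and> p i j \<le> 12 * P"
proof -
  \<comment> \<open>The weights give each of the four terms an average of at most 1, so
    \<open>T\<close> sums to at most 1 + 1 + 4 = 6. Markov's inequality at twice this value gives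
    the threshold 12, and 12 / 100 <= 1 / 4.\<close>
  define u where "u i j = 100 * e1 i j + 100 * e2 i j + 100 * e3 i j + p i j / P" for i j
  define T where "T j = A j / V + B j / V + (\<Sum>i<m1. u i j) / (real m1 * real m2)" for j
  have u0: "0 \<le> u i j" for i j
    using nonneg P by (simp add: u_def)
  have usum: "(\<Sum>i<m1. \<Sum>j<m2. u i j) \<le> 4 * (real m1 * real m2)"
  proof -
    have "(\<Sum>i<m1. \<Sum>j<m2. u i j) = 100 * (\<Sum>i<m1. \<Sum>j<m2. e1 i j) + 100 * (\<Sum>i<m1. \<Sum>j<m2. e2 i j)
        + 100 * (\<Sum>i<m1. \<Sum>j<m2. e3 i j) + (\<Sum>i<m1. \<Sum>j<m2. p i j) / P"
      by (simp add: u_def sum.distrib sum_distrib_left sum_divide_distrib)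
    moreover have "(\<Sum>i<m1. \<Sum>j<m2. p i j) / P \<le> real m1 * real m2"
      using p P by (simp add: divide_le_eq mult.commute)
    ultimately show ?thesis using e by linarith
  qed
  have swap: "(\<Sum>i<m1. \<Sum>j<m2. u i j) = (\<Sum>j<m2. \<Sum>i<m1. u i j)"
    by (rule sum.swap)
  have "(\<Sum>j<m2. T j) = (\<Sum>j<m2. A j) / V + (\<Sum>j<m2. B j) / V + (\<Sum>i<m1. \<Sum>j<m2. u i j) / (real m1 * real m2)"
    unfolding T_def sum.distrib sum_divide_distrib[symmetric] by (simp only: swap)
  also have "\<dots> \<le> 1 + 1 + 4"
    using AB V usum m by (intro add_mono) (simp_all add: divide_le_eq)
  finally have Tsum: "(\<Sum>j<m2. T j) \<le> 6" by simp
  obtain j where j: "j < m2" "T j \<le> 6 / real m2"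
  proof (rule ccontr)
    assume "\<not> thesis"
    then have "6 / real m2 < T j" if "j < m2" for j
      using that \<open>\<And>j. j < m2 \<Longrightarrow> T j \<le> 6 / real m2 \<Longrightarrow> thesis\<close> by force
    then have "(\<Sum>j<m2. 6 / real m2) < (\<Sum>j<m2. T j)"
      using m by (intro sum_strict_mono) auto
    then show False using Tsum m by simp
  qed
  have nn: "0 \<le> A j / V" "0 \<le> B j / V" "0 \<le> (\<Sum>i<m1. u i j) / (real m1 * real m2)"
    using nonneg V u0 by (auto intro!: divide_nonneg_nonneg sum_nonneg)
  have A: "A j / V \<le> 6 / real m2" and B: "B j / V \<le> 6 / real m2"
    and us: "(\<Sum>i<m1. u i j) / (real m1 * real m2) \<le> 6 / real m2"
    using j(2) nn unfolding T_def by linarith+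
  have us': "(\<Sum>i<m1. u i j) \<le> 6 * real m1"
    using us m by (simp add: field_simps)
  define G where "G = {i \<in> {..<m1}. u i j \<le> 12}"
  have "12 * real (card ({..<m1} - G)) = (\<Sum>i\<in>{..<m1} - G. 12)"
    by simp
  also have "\<dots> \<le> (\<Sum>i\<in>{..<m1} - G. u i j)"
    by (intro sum_mono) (auto simp: G_def)
  also have "\<dots> \<le> (\<Sum>i<m1. u i j)"
    using u0 by (intro sum_mono2) auto
  finally have "2 * real (card ({..<m1} - G)) \<le> real m1"
    using us' by simp
  moreover have "card ({..<m1} - G) + card G = m1"
  proof -
    have "G \<subseteq> {..<m1}" by (auto simp: G_def)
    then show ?thesis
      using card_Diff_subset[of G "{..<m1}"] card_mono[of "{..<m1}" G] finite_subset[of G "{..<m1}"]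
      by simp
  qed
  ultimately have Gc: "real m1 \<le> 2 * real (card G)"
    by linarith
  show thesis
  proof (rule that[OF j(1) _ _ _ Gc])
    show "A j \<le> 6 * V / real m2" "B j \<le> 6 * V / real m2"
      using A B V by (simp_all add: field_simps)
    show "G \<subseteq> {..<m1}" by (auto simp: G_def)
    fix i assume "i \<in> G"
    then have ui: "u i j \<le> 12" by (simp add: G_def)
    have "0 \<le> p i j / P" using nonneg P by simp
    then have "100 * e1 i j \<le> 12" "100 * e2 i j \<le> 12" "100 * e3 i j \<le> 12" "p i j / P \<le> 12"
      using ui nonneg(1)[of i j] nonneg(2)[of i j] nonneg(3)[of i j] unfolding u_def by linarith+
    then show "e1 i j \<le> 1 / 4 \<and> e2 i j \<le> 1 / 4 \<and> e3 i j \<le> 1 / 4 \<and> p i j \<le> 12 * P"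
      using P by (simp add: divide_le_eq)
  qed
qed

text \<open>The value \<open>undefined\<close> away from 1 and 2 makes the tuple extensional, as
  membership in \<open>messages 2 m\<close> demands.\<close>

definition pair_message :: "nat \<Rightarrow> nat \<Rightarrow> nat \<Rightarrow> nat" where
  "pair_message i j = (\<lambda>k. if k = 1 then i else if k = 2 then j else undefined)"

lemma sum_messages_2:
  "(\<Sum>w\<in>messages 2 m. f w) = (\<Sum>i<m 1. \<Sum>j<m 2. f (pair_message i j))"
proof -
  have "(\<Sum>w\<in>messages 2 m. f w) = (\<Sum>(i, j)\<in>{..<m 1} \<times> {..<m 2}. f (pair_message i j))"
  proof (rule sum.reindex_bij_witness[of _ "\<lambda>(i, j). pair_message i j" "\<lambda>w. (w 1, w 2)"])
    fix w assume w: "w \<in> messages 2 m"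
    have eq: "pair_message (w 1) (w 2) = w"
    proof
      fix k :: nat
      have "k \<in> {1..2} \<longleftrightarrow> k = 1 \<or> k = 2" by auto
      then show "pair_message (w 1) (w 2) k = w k"
        using PiE_arb[OF w[unfolded messages_def], of k] unfolding pair_message_def by metis
    qed
    show "(case (w 1, w 2) of (i, j) \<Rightarrow> pair_message i j) = w"
      "(case (w 1, w 2) of (i, j) \<Rightarrow> f (pair_message i j)) = f w"
      by (simp_all only: prod.case eq)
    show "(w 1, w 2) \<in> {..<m 1} \<times> {..<m 2}"
      using messages_2[OF w] by simp
  next
    fix ij :: "nat \<times> nat" assume ij: "ij \<in> {..<m 1} \<times> {..<m 2}"
    obtain i j where eq: "ij = (i, j)" by (cases ij)
    have lt: "i < m 1" "j < m 2"
      using ij unfolding eq by auto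
    show "(case ij of (i, j) \<Rightarrow> pair_message i j) \<in> messages 2 m"
      unfolding eq messages_def prod.case
    proof (rule PiE_I)
      fix k :: nat assume "k \<in> {1..2}"
      then have "k = 1 \<or> k = 2" by auto
      then show "pair_message i j k \<in> {..<m k}"
        using lt by (auto simp: pair_message_def)
    next
      fix k :: nat assume "k \<notin> {1..2}"
      then have "k \<noteq> 1" "k \<noteq> 2" by auto
      then show "pair_message i j k = undefined"
        by (simp add: pair_message_def)
    qed
    show "((case ij of (i, j) \<Rightarrow> pair_message i j) 1, (case ij of (i, j) \<Rightarrow> pair_message i j) 2) = ij"
      unfolding eq by (simp add: pair_message_def)
  qed
  then show ?thesis
    by (simp add: sum.cartesian_product)
qed

section \<open>From decoding probabilities to volumes\<close>

lemma measurable_received [measurable]: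
  "received n h x \<in> Pi\<^sub>M {..<n} (\<lambda>_. borel) \<rightarrow>\<^sub>M Pi\<^sub>M {..<n} (\<lambda>_. borel)"
  unfolding received_def by (intro measurable_restrict) auto

text \<open>Union bound: decoding errors cost at most 1/4, and so does noise of large energy, since
  2 / exp 2 <= 1/2 and n >= 2.\<close>

lemma prob_decoded_ge_half:
  assumes [measurable]: "g \<in> Pi\<^sub>M {..<n} (\<lambda>_. borel) \<rightarrow>\<^sub>M count_space UNIV"
    and n: "2 \<le> n" and err: "\<P>(z in noise n. g (received n h x z) \<noteq> k) \<le> 1 / 4"
  shows "1 / 2 \<le> \<P>(z in noise n. g (received n h x z) = k \<and> (\<Sum>t<n. (norm (z t))\<^sup>2) \<le> 4 * real n)"
proof -
  interpret prob_space "noise n" by (rule prob_space_noise)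
  let ?E = "{z \<in> space (noise n). g (received n h x z) \<noteq> k}"
  let ?L = "{z \<in> space (noise n). 4 * real n < (\<Sum>t<n. (norm (z t))\<^sup>2)}"
  let ?S = "{z \<in> space (noise n). g (received n h x z) = k \<and> (\<Sum>t<n. (norm (z t))\<^sup>2) \<le> 4 * real n}"
  have [measurable]: "?E \<in> events" "?L \<in> events" "?S \<in> events" by measurable
  have e: "4 \<le> exp (2::real)"
  proof -
    have "(2::real) * 2 \<le> exp 1 * exp 1"
      using exp_ge_add_one_self[of "1::real"] by (intro mult_mono) auto
    then show ?thesis by (simp add: exp_add[symmetric])
  qed
  have "(2 / exp 2) ^ n \<le> (1 / 2 :: real) ^ n"
    using e by (intro power_mono) (auto simp: field_simps)
  also have "\<dots> \<le> (1 / 2) ^ 2"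
    using n by (intro power_decreasing) auto
  finally have L: "prob ?L \<le> 1 / 4"
    using noise_tail[of n] by (simp add: power2_eq_square)
  have "1 = prob (space (noise n))" by (simp add: prob_space del: space_noise)
  also have "\<dots> \<le> prob (?S \<union> (?E \<union> ?L))"
    by (intro finite_measure_mono) auto
  also have "\<dots> \<le> prob ?S + (prob ?E + prob ?L)"
    by (intro order.trans[OF measure_Un_le] add_mono order.refl) auto
  finally show ?thesis
    using L err by linarith
qed

text \<open>On an event of probability at least 1/2 the function \<open>F\<close> of the output is
  at least \<open>c\<close>, and the noise density is at most 1. With \<open>F\<close> an indicator
  this bounds the volume of a decoding region from below; with \<open>F\<close> an inner integral it
  can be iterated.\<close>

lemma nn_integral_leb_ge_decoded:
  assumes g: "g \<in> Pi\<^sub>M {..<n} (\<lambda>_. borel) \<rightarrow>\<^sub>M count_space UNIV"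
    and n: "2 \<le> n" and err: "\<P>(z in noise n. g (received n h x z) \<noteq> k) \<le> 1 / 4"
    and F: "F \<in> borel_measurable (Pi\<^sub>M {..<n} (\<lambda>_. borel))"
    and le: "\<And>z. z \<in> space (noise n) \<Longrightarrow> g (received n h x z) = k \<Longrightarrow>
      (\<Sum>t<n. (norm (z t))\<^sup>2) \<le> 4 * real n \<Longrightarrow> c \<le> F (received n h x z)"
  shows "c * ennreal (1 / 2) \<le> (\<integral>\<^sup>+y. F y \<partial>leb n)"
proof -
  interpret prob_space "noise n" by (rule prob_space_noise)
  note g [measurable]
  let ?S = "{z \<in> space (noise n). g (received n h x z) = k \<and> (\<Sum>t<n. (norm (z t))\<^sup>2) \<le> 4 * real n}"
  have S: "?S \<in> events" by measurable
  have "c * ennreal (1 / 2) \<le> c * emeasure (noise n) ?S"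
    by (intro mult_left_mono, unfold emeasure_eq_measure, rule ennreal_leI)
       (rule prob_decoded_ge_half[OF g n err], rule zero_le)
  also have "\<dots> = (\<integral>\<^sup>+z. c * indicator ?S z \<partial>noise n)"
    using S by (simp add: nn_integral_cmult_indicator)
  also have "\<dots> \<le> (\<integral>\<^sup>+z. F (received n h x z) \<partial>noise n)"
  proof (rule nn_integral_mono)
    show "c * indicator ?S z \<le> F (received n h x z)" if "z \<in> space (noise n)" for z
    proof (cases "z \<in> ?S")
      case True
      then show ?thesis using le[OF that] by simp
    next
      case False
      then have "indicator ?S z = (0 :: ennreal)" by (rule indicator_simps(2))
      then show ?thesis by (simp only: mult_zero_right zero_le)
    qed
  qed
  also have "\<dots> \<le> (\<integral>\<^sup>+y. F y \<partial>leb n)"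
    unfolding received_def by (rule nn_integral_translate_noise_le[OF F])
  finally show ?thesis .
qed

lemma norm_row_times_le: "norm (row_times h x) \<le> (\<Sum>i\<in>UNIV. norm (h $ i)) * norm x"
proof -
  have "norm (row_times h x) \<le> (\<Sum>i\<in>UNIV. norm (h $ i * x $ i))"
    unfolding row_times_def by (rule norm_sum)
  also have "\<dots> \<le> (\<Sum>i\<in>UNIV. norm (h $ i) * norm x)"
    by (intro sum_mono) (auto simp: norm_mult intro!: mult_left_mono Finite_Cartesian_Product.norm_nth_le)
  finally show ?thesis by (simp add: sum_distrib_right)
qed

text \<open>By (u + v)^2 <= 2 u^2 + 2 v^2, the input contributes 24 = 2 * 12 and the noise 8 = 2 *
  4; the latter is absorbed into the factor \<open>P\<close> because P >= 1.\<close>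

lemma received_power_le:
  assumes P: "1 \<le> P" and N: "(\<Sum>i\<in>UNIV. norm (h $ i)) \<le> N"
    and x: "(\<Sum>t<n. (norm (x t))\<^sup>2) \<le> real n * (12 * P)"
    and z: "(\<Sum>t<n. (norm (z t))\<^sup>2) \<le> 4 * real n"
  shows "(\<Sum>t<n. (norm (received n h x z t))\<^sup>2) \<le> real n * ((24 * N\<^sup>2 + 8) * P)"
proof -
  have sq: "(u + v)\<^sup>2 \<le> 2 * u\<^sup>2 + 2 * v\<^sup>2" for u v :: real
    using sum_squares_bound[of u v] by (simp add: power2_eq_square algebra_simps)
  have "(norm (received n h x z t))\<^sup>2 \<le> 2 * N\<^sup>2 * (norm (x t))\<^sup>2 + 2 * (norm (z t))\<^sup>2" if "t < n" for t
  proof -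
    have "norm (row_times h (x t)) \<le> N * norm (x t)"
      by (rule order.trans[OF norm_row_times_le mult_right_mono[OF N]]) simp
    then have "norm (received n h x z t) \<le> N * norm (x t) + norm (z t)"
      using that by (auto simp: received_def intro!: norm_triangle_le)
    then have "(norm (received n h x z t))\<^sup>2 \<le> (N * norm (x t) + norm (z t))\<^sup>2"
      by (intro power_mono) auto
    also have "\<dots> \<le> 2 * (N * norm (x t))\<^sup>2 + 2 * (norm (z t))\<^sup>2"
      by (rule sq)
    finally show ?thesis by (simp add: power_mult_distrib)
  qed
  then have "(\<Sum>t<n. (norm (received n h x z t))\<^sup>2)
      \<le> (\<Sum>t<n. 2 * N\<^sup>2 * (norm (x t))\<^sup>2 + 2 * (norm (z t))\<^sup>2)"
    by (intro sum_mono) auto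
  also have "\<dots> = 2 * N\<^sup>2 * (\<Sum>t<n. (norm (x t))\<^sup>2) + 2 * (\<Sum>t<n. (norm (z t))\<^sup>2)"
    by (simp add: sum.distrib sum_distrib_left)
  also have "\<dots> \<le> 2 * N\<^sup>2 * (real n * (12 * P)) + 2 * (4 * real n)"
    using x z by (intro add_mono mult_left_mono) auto
  also have "\<dots> \<le> real n * ((24 * N\<^sup>2 + 8) * P)"
    using mult_left_mono[OF P, of "8 * real n"] by (simp add: algebra_simps)
  finally show ?thesis .
qed

text \<open>The energy cut-off makes the volume finite. By \<open>received_power_le\<close>, a
  suitable \<rho> of order P keeps every output that comes from a codeword of bounded power and
  typical noise.\<close>

definition region :: "nat \<Rightarrow> real \<Rightarrow> ((nat \<Rightarrow> complex) \<Rightarrow> nat) \<Rightarrow> nat \<Rightarrow> (nat \<Rightarrow> complex) set" where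
  "region n \<rho> g k = {y \<in> space (Pi\<^sub>M {..<n} (\<lambda>_. borel)). g y = k \<and> (\<Sum>t<n. (norm (y t))\<^sup>2) \<le> real n * \<rho>}"

lemma sets_region:
  assumes [measurable]: "g \<in> Pi\<^sub>M {..<n} (\<lambda>_. borel) \<rightarrow>\<^sub>M count_space UNIV"
  shows "region n \<rho> g k \<in> sets (leb n)"
  unfolding region_def sets_leb by measurable

text \<open>Regions of distinct messages are disjoint and lie in one common ball.\<close>

lemma sum_emeasure_region_le:
  assumes g: "g \<in> Pi\<^sub>M {..<n} (\<lambda>_. borel) \<rightarrow>\<^sub>M count_space UNIV" and \<rho>: "0 < \<rho>" and K: "finite K"
  shows "(\<Sum>k\<in>K. emeasure (leb n) (region n \<rho> g k)) \<le> ennreal ((exp 1 * pi * \<rho>) ^ n)"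
proof -
  have "(\<Sum>k\<in>K. emeasure (leb n) (region n \<rho> g k)) = emeasure (leb n) (\<Union>k\<in>K. region n \<rho> g k)"
    using K sets_region[OF g] by (intro sum_emeasure) (auto simp: disjoint_family_on_def region_def)
  also have "\<dots> \<le> emeasure (leb n) {y \<in> space (leb n). (\<Sum>t<n. (norm (y t - 0))\<^sup>2) \<le> real n * \<rho>}"
  proof (rule emeasure_mono)
    show "{y \<in> space (leb n). (\<Sum>t<n. (norm (y t - 0))\<^sup>2) \<le> real n * \<rho>} \<in> sets (leb n)"
      by measurable
  qed (auto simp: region_def)
  also have "\<dots> \<le> ennreal ((exp 1 * pi * \<rho>) ^ n)"
    by (rule emeasure_leb_ball_le[OF \<rho>])
  finally show ?thesis .
qed

lemma emeasure_region_eq: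
  assumes "g \<in> Pi\<^sub>M {..<n} (\<lambda>_. borel) \<rightarrow>\<^sub>M count_space UNIV" "0 < \<rho>"
  shows "emeasure (leb n) (region n \<rho> g k) = ennreal (measure (leb n) (region n \<rho> g k))"
  using sum_emeasure_region_le[OF assms, of "{k}"]
  by (intro emeasure_eq_ennreal_measure) (auto simp: top_unique)

lemma sum_measure_region_le:
  assumes g: "g \<in> Pi\<^sub>M {..<n} (\<lambda>_. borel) \<rightarrow>\<^sub>M count_space UNIV" and \<rho>: "0 < \<rho>" and K: "finite K"
  shows "(\<Sum>k\<in>K. measure (leb n) (region n \<rho> g k)) \<le> (exp 1 * pi * \<rho>) ^ n"
proof -
  have "ennreal (\<Sum>k\<in>K. measure (leb n) (region n \<rho> g k)) \<le> ennreal ((exp 1 * pi * \<rho>) ^ n)"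
    using sum_emeasure_region_le[OF assms] by (simp add: emeasure_region_eq[OF g \<rho>])
  moreover have "0 \<le> (exp 1 * pi * \<rho>) ^ n" using \<rho> by simp
  ultimately show ?thesis by (simp add: ennreal_le_iff)
qed

text \<open>The single-user bound R1 <= log P + O(1) in volume form: each good message occupies a
  region of volume at least 1/2, and all these regions share a ball of volume at most (C
  P)^n.\<close>

lemma card_le_single_volume:
  fixes g :: "(nat \<Rightarrow> complex) \<Rightarrow> nat"
  assumes g: "g \<in> Pi\<^sub>M {..<n} (\<lambda>_. borel) \<rightarrow>\<^sub>M count_space UNIV"
    and n: "2 \<le> n" and P: "1 \<le> P" and N: "(\<Sum>i\<in>UNIV. norm (h $ i)) \<le> N"
    and G: "finite G"
    and err: "\<And>i. i \<in> G \<Longrightarrow> \<P>(z in noise n. g (received n h (x i) z) \<noteq> i) \<le> 1 / 4"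
    and x: "\<And>i. i \<in> G \<Longrightarrow> (\<Sum>t<n. (norm (x i t))\<^sup>2) \<le> real n * (12 * P)"
  shows "real (card G) / 2 \<le> (exp 1 * pi * ((24 * N\<^sup>2 + 8) * P)) ^ n"
proof -
  let ?\<rho> = "(24 * N\<^sup>2 + 8) * P"
  have \<rho>: "0 < ?\<rho>" using P by (intro mult_pos_pos add_nonneg_pos) auto
  have half: "1 / 2 \<le> measure (leb n) (region n ?\<rho> g i)" if i: "i \<in> G" for i
  proof -
    have "1 * ennreal (1 / 2) \<le> (\<integral>\<^sup>+y. indicator (region n ?\<rho> g i) y \<partial>leb n)"
    proof (rule nn_integral_leb_ge_decoded[OF g n err[OF i]])
      show "indicator (region n ?\<rho> g i) \<in> borel_measurable (Pi\<^sub>M {..<n} (\<lambda>_. borel))"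
        using sets_region[OF g, of ?\<rho> i] unfolding sets_leb by simp
      fix z assume z: "z \<in> space (noise n)" "g (received n h (x i) z) = i"
        "(\<Sum>t<n. (norm (z t))\<^sup>2) \<le> 4 * real n"
      have "received n h (x i) z \<in> region n ?\<rho> g i"
        using z received_power_le[OF P N x[OF i] z(3)] measurable_space[OF measurable_received]
        unfolding region_def by auto
      then show "1 \<le> (indicator (region n ?\<rho> g i) (received n h (x i) z) :: ennreal)"
        by simp
    qed
    then have "ennreal (1 / 2) \<le> ennreal (measure (leb n) (region n ?\<rho> g i))"
      using sets_region[OF g, of ?\<rho> i] emeasure_region_eq[OF g \<rho>, of i] by simp
    then show ?thesis
      by (subst (asm) ennreal_le_iff) auto
  qed
  have "real (card G) / 2 = (\<Sum>i\<in>G. 1 / 2)" by simp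
  also have "\<dots> \<le> (\<Sum>i\<in>G. measure (leb n) (region n ?\<rho> g i))"
    by (intro sum_mono half)
  also have "\<dots> \<le> (exp 1 * pi * ?\<rho>) ^ n"
    by (rule sum_measure_region_le[OF g \<rho> G])
  finally show ?thesis .
qed

text \<open>
  Once the message \<open>j\<close> of user 2 is fixed, the outputs \<open>u\<close>, \<open>v\<close> at two states of user 2 determine
  the noiseless output of user 1 up to noise, so that the pairs of regions in which both states
  decode \<open>j\<close> must host all the messages of user 1.
\<close>

lemma card_le_product_volume:
  fixes h1 a b :: "complex ^ 2" and gy ga gb :: "(nat \<Rightarrow> complex) \<Rightarrow> nat"
  assumes gy: "gy \<in> Pi\<^sub>M {..<n} (\<lambda>_. borel) \<rightarrow>\<^sub>M count_space UNIV"
    and ga: "ga \<in> Pi\<^sub>M {..<n} (\<lambda>_. borel) \<rightarrow>\<^sub>M count_space UNIV"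
    and gb: "gb \<in> Pi\<^sub>M {..<n} (\<lambda>_. borel) \<rightarrow>\<^sub>M count_space UNIV"
    and n: "2 \<le> n" and P: "1 \<le> P"
    and N: "(\<Sum>i\<in>UNIV. norm (a $ i)) \<le> N" "(\<Sum>i\<in>UNIV. norm (b $ i)) \<le> N"
    and row: "\<And>x. row_times h1 x = \<alpha> * row_times a x + \<beta> * row_times b x"
    and G: "finite G"
    and erry: "\<And>i. i \<in> G \<Longrightarrow> \<P>(z in noise n. gy (received n h1 (x i) z) \<noteq> i) \<le> 1 / 4"
    and erra: "\<And>i. i \<in> G \<Longrightarrow> \<P>(z in noise n. ga (received n a (x i) z) \<noteq> j) \<le> 1 / 4"
    and errb: "\<And>i. i \<in> G \<Longrightarrow> \<P>(z in noise n. gb (received n b (x i) z) \<noteq> j) \<le> 1 / 4"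
    and x: "\<And>i. i \<in> G \<Longrightarrow> (\<Sum>t<n. (norm (x i t))\<^sup>2) \<le> real n * (12 * P)"
    and \<rho>_def: "\<rho> = (24 * N\<^sup>2 + 8) * P"
    and \<sigma>_def: "\<sigma> = 12 * (1 + (norm \<alpha>)\<^sup>2 + (norm \<beta>)\<^sup>2)"
  shows "real (card G) / 8 \<le> measure (leb n) (region n \<rho> ga j) * measure (leb n) (region n \<rho> gb j)
    * (exp 1 * pi * \<sigma>) ^ n"
proof -
  note gy [measurable]
  have \<rho>: "0 < \<rho>" unfolding \<rho>_def using P by (intro mult_pos_pos add_nonneg_pos) auto
  have \<sigma>: "0 < \<sigma>" unfolding \<sigma>_def by (intro mult_pos_pos add_pos_nonneg) auto
  interpret L: sigma_finite_measure "leb n" by (rule lborel_prod.sigma_finite) simp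
  let ?X = "Pi\<^sub>M {..<n} (\<lambda>_. borel :: complex measure)"
  let ?A = "region n \<rho> ga j" and ?B = "region n \<rho> gb j"
  note [measurable] = sets_region[OF ga, of \<rho> j, unfolded sets_leb] sets_region[OF gb, of \<rho> j, unfolded sets_leb]
  \<comment> \<open>The indicator that an output \<open>y\<close> of user 1 decodes to
    \<open>i\<close> and is as close to its prediction \<alpha> u + \<beta> v as typical noise
    allows.\<close>
  define f :: "nat \<Rightarrow> (nat \<Rightarrow> complex) \<Rightarrow> (nat \<Rightarrow> complex) \<Rightarrow> (nat \<Rightarrow> complex) \<Rightarrow> ennreal" where
    "f i u v y = (if gy y = i \<and> (\<Sum>t<n. (norm (y t - (\<alpha> * u t + \<beta> * v t)))\<^sup>2) \<le> real n * \<sigma> then 1 else 0)" for i u v y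
  define \<phi> where "\<phi> i u v = (\<integral>\<^sup>+y. f i u v y \<partial>leb n)" for i u v
  have fm: "(\<lambda>((u, v), y). f i u v y) \<in> borel_measurable ((?X \<Otimes>\<^sub>M ?X) \<Otimes>\<^sub>M ?X)" for i
  proof -
    have "(\<lambda>p. f i (fst (fst p)) (snd (fst p)) (snd p)) \<in> borel_measurable ((?X \<Otimes>\<^sub>M ?X) \<Otimes>\<^sub>M ?X)"
      unfolding f_def by measurable
    then show ?thesis by (simp add: case_prod_unfold)
  qed
  have \<phi>m [measurable]: "(\<lambda>(u, v). \<phi> i u v) \<in> borel_measurable (?X \<Otimes>\<^sub>M ?X)" for i
  proof -
    have "(\<lambda>((u, v), y). f i u v y) \<in> borel_measurable ((?X \<Otimes>\<^sub>M ?X) \<Otimes>\<^sub>M leb n)"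
      using fm[of i] by (simp cong: measurable_cong_sets sets_pair_measure_cong add: sets_leb)
    from L.borel_measurable_nn_integral_fst[OF this] show ?thesis
      by (simp add: \<phi>_def case_prod_unfold)
  qed
  have \<phi>m1: "(\<lambda>v. \<phi> i u v) \<in> borel_measurable ?X" if "u \<in> space ?X" for i u
    using measurable_compose[OF measurable_Pair1'[OF that] \<phi>m] by simp
  have fm1: "f i u v \<in> borel_measurable ?X" if "u \<in> space ?X" "v \<in> space ?X" for i u v
    using measurable_compose[OF measurable_Pair1'[of "(u, v)" "?X \<Otimes>\<^sub>M ?X"] fm] that
    by (simp add: space_pair_measure)
  define \<psi> where "\<psi> i u = (\<integral>\<^sup>+v. indicator ?B v * \<phi> i u v \<partial>leb n)" for i u
  have \<psi>m [measurable]: "\<psi> i \<in> borel_measurable ?X" for i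
  proof -
    have "(\<lambda>(u, v). indicator ?B v * \<phi> i u v) \<in> borel_measurable (?X \<Otimes>\<^sub>M ?X)"
      by measurable
    then have "(\<lambda>(u, v). indicator ?B v * \<phi> i u v) \<in> borel_measurable (?X \<Otimes>\<^sub>M leb n)"
      by (simp cong: measurable_cong_sets sets_pair_measure_cong add: sets_leb)
    from L.borel_measurable_nn_integral[OF this] show ?thesis
      by (simp add: \<psi>_def[abs_def])
  qed
  have rec: "received n h (x i) z \<in> space ?X" if "z \<in> space (noise n)" for h :: "complex ^ 2" and i z
    using measurable_space[OF measurable_received] that by simp
  have tri: "(norm (p - (\<alpha> * q + \<beta> * r)))\<^sup>2 \<le> 3 * ((norm p)\<^sup>2 + (norm \<alpha>)\<^sup>2 * (norm q)\<^sup>2 + (norm \<beta>)\<^sup>2 * (norm r)\<^sup>2)" for p q r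
  proof -
    have sq: "(u + v + w)\<^sup>2 \<le> 3 * (u\<^sup>2 + v\<^sup>2 + w\<^sup>2)" for u v w :: real
      using sum_squares_bound[of u v] sum_squares_bound[of u w] sum_squares_bound[of v w]
      by (simp add: power2_eq_square algebra_simps)
    have "norm (p - (\<alpha> * q + \<beta> * r)) \<le> norm p + norm \<alpha> * norm q + norm \<beta> * norm r"
      using norm_triangle_ineq4[of p "\<alpha> * q + \<beta> * r"] norm_triangle_ineq[of "\<alpha> * q" "\<beta> * r"]
      by (simp add: norm_mult)
    then have "(norm (p - (\<alpha> * q + \<beta> * r)))\<^sup>2 \<le> (norm p + norm \<alpha> * norm q + norm \<beta> * norm r)\<^sup>2"
      by (intro power_mono) auto
    also note sq
    finally show ?thesis by (simp only: power_mult_distrib)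
  qed
  \<comment> \<open>\<open>s1\<close>, \<open>s2\<close> and \<open>s3\<close> integrate in turn
    over the output of user 1, that of state \<open>b\<close> and that of state \<open>a\<close>,
    each with a noise of its own. Each loses a factor 1/2, which produces the 8 in the
    conclusion.\<close>
  have s1: "ennreal (1 / 2) \<le> \<phi> i (received n a (x i) z1) (received n b (x i) z2)"
    if i: "i \<in> G" and z1: "z1 \<in> space (noise n)" "(\<Sum>t<n. (norm (z1 t))\<^sup>2) \<le> 4 * real n"
      and z2: "z2 \<in> space (noise n)" "(\<Sum>t<n. (norm (z2 t))\<^sup>2) \<le> 4 * real n" for i z1 z2
  proof -
    let ?u = "received n a (x i) z1" and ?v = "received n b (x i) z2"
    have "1 * ennreal (1 / 2) \<le> (\<integral>\<^sup>+y. f i ?u ?v y \<partial>leb n)"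
    proof (rule nn_integral_leb_ge_decoded[OF gy n erry[OF i] fm1[OF rec[OF z1(1)] rec[OF z2(1)]]])
      fix z3 assume z3: "z3 \<in> space (noise n)" "gy (received n h1 (x i) z3) = i"
        "(\<Sum>t<n. (norm (z3 t))\<^sup>2) \<le> 4 * real n"
      \<comment> \<open>The transmitted signal cancels by \<open>row\<close>. What is left combines
        three noises of energy at most 4 n each, and \<open>tri\<close> bounds it by n
        \<sigma>.\<close>
      have "(\<Sum>t<n. (norm (received n h1 (x i) z3 t - (\<alpha> * ?u t + \<beta> * ?v t)))\<^sup>2)
          = (\<Sum>t<n. (norm (z3 t - (\<alpha> * z1 t + \<beta> * z2 t)))\<^sup>2)"
        by (intro sum.cong) (auto simp: received_def row algebra_simps)
      also have "\<dots> \<le> (\<Sum>t<n. 3 * ((norm (z3 t))\<^sup>2 + (norm \<alpha>)\<^sup>2 * (norm (z1 t))\<^sup>2 + (norm \<beta>)\<^sup>2 * (norm (z2 t))\<^sup>2))"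
        by (intro sum_mono tri)
      also have "\<dots> = 3 * ((\<Sum>t<n. (norm (z3 t))\<^sup>2) + (norm \<alpha>)\<^sup>2 * (\<Sum>t<n. (norm (z1 t))\<^sup>2)
          + (norm \<beta>)\<^sup>2 * (\<Sum>t<n. (norm (z2 t))\<^sup>2))"
        by (simp only: sum.distrib sum_distrib_left[symmetric])
      also have "\<dots> \<le> 3 * (4 * real n + (norm \<alpha>)\<^sup>2 * (4 * real n) + (norm \<beta>)\<^sup>2 * (4 * real n))"
        using z1 z2 z3 by (intro mult_left_mono add_mono) auto
      also have "\<dots> = real n * \<sigma>"
        by (simp add: \<sigma>_def algebra_simps)
      finally show "1 \<le> f i ?u ?v (received n h1 (x i) z3)"
        using z3(2) by (simp add: f_def)
    qed
    then show ?thesis by (simp add: \<phi>_def)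
  qed
  have s2: "ennreal (1 / 4) \<le> \<psi> i (received n a (x i) z1)"
    if i: "i \<in> G" and z1: "z1 \<in> space (noise n)" "(\<Sum>t<n. (norm (z1 t))\<^sup>2) \<le> 4 * real n" for i z1
  proof -
    let ?u = "received n a (x i) z1"
    have "ennreal (1 / 2) * ennreal (1 / 2) \<le> \<psi> i ?u"
      unfolding \<psi>_def
    proof (rule nn_integral_leb_ge_decoded[OF gb n errb[OF i]])
      show "(\<lambda>v. indicator ?B v * \<phi> i ?u v) \<in> borel_measurable ?X"
        using \<phi>m1[OF rec[OF z1(1)]] by measurable
      fix z2 assume z2: "z2 \<in> space (noise n)" "gb (received n b (x i) z2) = j"
        "(\<Sum>t<n. (norm (z2 t))\<^sup>2) \<le> 4 * real n"
      have "received n b (x i) z2 \<in> ?B"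
        using rec[OF z2(1)] z2(2) received_power_le[OF P N(2) x[OF i] z2(3)]
        by (simp add: region_def \<rho>_def)
      then show "ennreal (1 / 2) \<le> indicator ?B (received n b (x i) z2) * \<phi> i ?u (received n b (x i) z2)"
        using s1[OF i z1 z2(1,3)] by (simp only: indicator_simps mult_1_left)
    qed
    moreover have "ennreal (1 / 4) = ennreal (1 / 2) * ennreal (1 / 2)"
      by (subst ennreal_mult[symmetric]) simp_all
    ultimately show ?thesis by (simp only:)
  qed
  have s3: "ennreal (1 / 8) \<le> (\<integral>\<^sup>+u. indicator ?A u * \<psi> i u \<partial>leb n)" if i: "i \<in> G" for i
  proof -
    have "ennreal (1 / 4) * ennreal (1 / 2) \<le> (\<integral>\<^sup>+u. indicator ?A u * \<psi> i u \<partial>leb n)"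
    proof (rule nn_integral_leb_ge_decoded[OF ga n erra[OF i]])
      show "(\<lambda>u. indicator ?A u * \<psi> i u) \<in> borel_measurable ?X"
        by measurable
      fix z1 assume z1: "z1 \<in> space (noise n)" "ga (received n a (x i) z1) = j"
        "(\<Sum>t<n. (norm (z1 t))\<^sup>2) \<le> 4 * real n"
      have "received n a (x i) z1 \<in> ?A"
        using rec[OF z1(1)] z1(2) received_power_le[OF P N(1) x[OF i] z1(3)]
        by (simp add: region_def \<rho>_def)
      then show "ennreal (1 / 4) \<le> indicator ?A (received n a (x i) z1) * \<psi> i (received n a (x i) z1)"
        using s2[OF i z1(1,3)] by (simp only: indicator_simps mult_1_left)
    qed
    moreover have "ennreal (1 / 8) = ennreal (1 / 4) * ennreal (1 / 2)"
      by (subst ennreal_mult[symmetric]) simp_all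
    ultimately show ?thesis by (simp only:)
  qed
  let ?V = "ennreal ((exp 1 * pi * \<sigma>) ^ n)"
  \<comment> \<open>For fixed \<open>u\<close> and \<open>v\<close> each \<open>y\<close> decodes to
    a single message, so the sum over \<open>G\<close> counts every point of the ball at most
    once.\<close>
  have \<phi>sum: "(\<Sum>i\<in>G. \<phi> i u v) \<le> ?V" if "u \<in> space ?X" "v \<in> space ?X" for u v
  proof -
    have [measurable_cong]: "sets (leb n) = sets ?X" by (rule sets_leb)
    have "(\<Sum>i\<in>G. \<phi> i u v) = (\<integral>\<^sup>+y. (\<Sum>i\<in>G. f i u v y) \<partial>leb n)"
      unfolding \<phi>_def using fm1[OF that] by (intro nn_integral_sum[symmetric]) simp
    also have "\<dots> \<le> (\<integral>\<^sup>+y. indicator {y \<in> space (leb n). (\<Sum>t<n. (norm (y t - (\<alpha> * u t + \<beta> * v t)))\<^sup>2) \<le> real n * \<sigma>} y \<partial>leb n)"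
    proof (rule nn_integral_mono)
      fix y assume y: "y \<in> space (leb n)"
      have "(\<Sum>i\<in>G. f i u v y) \<le> (\<Sum>i\<in>G. if i = gy y then
          (if (\<Sum>t<n. (norm (y t - (\<alpha> * u t + \<beta> * v t)))\<^sup>2) \<le> real n * \<sigma> then 1 else 0) else 0)"
        by (intro sum_mono) (auto simp: f_def)
      also have "\<dots> \<le> indicator {y \<in> space (leb n). (\<Sum>t<n. (norm (y t - (\<alpha> * u t + \<beta> * v t)))\<^sup>2) \<le> real n * \<sigma>} y"
        using y G by (simp add: sum.delta indicator_def)
      finally show "(\<Sum>i\<in>G. f i u v y) \<le> indicator {y \<in> space (leb n). (\<Sum>t<n. (norm (y t - (\<alpha> * u t + \<beta> * v t)))\<^sup>2) \<le> real n * \<sigma>} y" .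
    qed
    also have "\<dots> = emeasure (leb n) {y \<in> space (leb n). (\<Sum>t<n. (norm (y t - (\<alpha> * u t + \<beta> * v t)))\<^sup>2) \<le> real n * \<sigma>}"
      by (rule nn_integral_indicator) measurable
    also have "\<dots> \<le> ?V"
      by (rule emeasure_leb_ball_le[OF \<sigma>])
    finally show ?thesis .
  qed
  have [measurable_cong]: "sets (leb n) = sets ?X" by (rule sets_leb)
  have "ennreal (real (card G) / 8) = (\<Sum>i\<in>G. ennreal (1 / 8))"
    by (simp add: ennreal_of_nat_eq_real_of_nat ennreal_mult[symmetric])
  also have "\<dots> \<le> (\<Sum>i\<in>G. \<integral>\<^sup>+u. indicator ?A u * \<psi> i u \<partial>leb n)"
    by (intro sum_mono s3)
  also have "\<dots> = (\<integral>\<^sup>+u. (\<Sum>i\<in>G. indicator ?A u * \<psi> i u) \<partial>leb n)"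
    by (intro nn_integral_sum[symmetric]) measurable
  also have "\<dots> \<le> (\<integral>\<^sup>+u. (emeasure (leb n) ?B * ?V) * indicator ?A u \<partial>leb n)"
  proof (rule nn_integral_mono)
    fix u assume "u \<in> space (leb n)"
    then have u: "u \<in> space ?X" by simp
    have "(\<Sum>i\<in>G. \<psi> i u) = (\<integral>\<^sup>+v. (\<Sum>i\<in>G. indicator ?B v * \<phi> i u v) \<partial>leb n)"
      unfolding \<psi>_def
      by (intro nn_integral_sum[symmetric], unfold measurable_cong_sets[OF sets_leb refl])
         (intro borel_measurable_times_ennreal borel_measurable_indicator \<phi>m1[OF u]
           sets_region[OF gb, unfolded sets_leb])
    also have "\<dots> \<le> (\<integral>\<^sup>+v. ?V * indicator ?B v \<partial>leb n)"
    proof (rule nn_integral_mono)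
      fix v assume "v \<in> space (leb n)"
      then have v: "v \<in> space ?X" by simp
      show "(\<Sum>i\<in>G. indicator ?B v * \<phi> i u v) \<le> ?V * indicator ?B v"
        unfolding sum_distrib_left[symmetric] mult.commute[of ?V]
        by (intro mult_left_mono \<phi>sum[OF u v] zero_le)
    qed
    also have "\<dots> = emeasure (leb n) ?B * ?V"
      by (subst nn_integral_cmult_indicator) (auto simp: mult.commute sets_region[OF gb])
    finally have "(\<Sum>i\<in>G. \<psi> i u) \<le> emeasure (leb n) ?B * ?V" .
    then show "(\<Sum>i\<in>G. indicator ?A u * \<psi> i u) \<le> emeasure (leb n) ?B * ?V * indicator ?A u"
      unfolding sum_distrib_left[symmetric] mult.commute[of _ "indicator ?A u"]
      by (intro mult_left_mono zero_le)
  qed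
  also have "\<dots> = emeasure (leb n) ?B * ?V * emeasure (leb n) ?A"
    by (subst nn_integral_cmult_indicator) (auto simp: sets_region[OF ga])
  also have "\<dots> = ennreal (measure (leb n) ?A * measure (leb n) ?B * (exp 1 * pi * \<sigma>) ^ n)"
    unfolding emeasure_region_eq[OF ga \<rho>] emeasure_region_eq[OF gb \<rho>]
    using \<sigma> by (simp add: ennreal_mult mult_ac)
  finally show ?thesis
    using \<sigma> by (subst (asm) ennreal_le_iff) (auto intro!: mult_nonneg_nonneg)
qed

subsection \<open>Generic channels are nondegenerate\<close>

lemma AE_lborel_not_in_negligible:
  fixes S :: "'a::euclidean_space set"
  assumes "negligible S" "S \<in> sets borel"
  shows "AE y in lborel. y \<notin> S"
proof -
  have "S \<in> null_sets lebesgue"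
    using assms(1) by (simp add: negligible_iff_null_sets)
  then have "S \<in> null_sets lborel"
    using assms(2) by (subst (asm) null_sets_completion_iff) simp_all
  then show ?thesis
    by (rule AE_not_in)
qed

lemma measurable_vec_nth_complex [measurable]: "(\<lambda>x :: complex ^ 2. x $ i) \<in> borel_measurable borel"
  by (intro borel_measurable_continuous_onI continuous_intros)

lemma measurable_det2 [measurable]:
  assumes [measurable]: "f \<in> M \<rightarrow>\<^sub>M borel" "g \<in> M \<rightarrow>\<^sub>M borel"
  shows "(\<lambda>x. det2 (f x) (g x)) \<in> borel_measurable M"
  unfolding det2_def by measurable

text \<open>Cramer's rule in dimension 2.\<close>

lemma det2_expansion: "det2 a b *s y = det2 y b *s a + det2 a y *s b"
  by (simp add: vec_eq_iff forall_2 det2_def algebra_simps)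

lemma bounded_linear_smult_vec: "bounded_linear (\<lambda>z :: complex. z *s (a :: complex ^ 2))"
  by (intro linear_conv_bounded_linear[THEN iffD1] linearI) (simp_all add: vec_eq_iff algebra_simps)

text \<open>The zero set is the complex line through \<open>a\<close>, of real dimension 2 in a
  space of real dimension 4.\<close>

lemma negligible_det2_zero:
  assumes "a \<noteq> 0"
  shows "negligible {y. det2 a y = 0}"
proof (rule negligible_subset)
  show "negligible (range (\<lambda>z :: complex. z *s a))"
    by (rule negligible_differentiable_image_lowdim)
       (simp_all add: bounded_linear_imp_differentiable_on bounded_linear_smult_vec)
  obtain k where k: "a $ k \<noteq> 0"
    using assms by (auto simp: vec_eq_iff)
  show "{y. det2 a y = 0} \<subseteq> range (\<lambda>z. z *s a)"
  proof
    fix y assume "y \<in> {y. det2 a y = 0}"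
    then have eq: "a $ 1 * y $ 2 = a $ 2 * y $ 1" by (simp add: det2_def)
    have "k = 1 \<or> k = 2" using exhaust_2 by blast
    then have "y = (y $ k / a $ k) *s a"
      using k eq by (auto simp: vec_eq_iff forall_2 field_simps)
    then show "y \<in> range (\<lambda>z. z *s a)" by blast
  qed
qed

text \<open>Off the line \<open>det2 y b = 0\<close> the condition says that
  \<open>\<kappa> * det2 y a\<close> is a real multiple r of \<open>det2 y b\<close>. By Cramer's
  rule \<open>y\<close> is then a differentiable function of r and \<open>det2 y b\<close>, that is,
  of three real parameters in a space of real dimension 4.\<close>

lemma negligible_aligned:
  assumes d: "det2 a b \<noteq> 0" and \<kappa>: "\<kappa> \<noteq> 0"
  shows "negligible {y. Im (\<kappa> * det2 y a * cnj (det2 y b)) = 0}"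
proof (rule negligible_subset)
  \<comment> \<open>\<open>A\<close> and \<open>B\<close> come from Cramer's rule after the
    substitution of - r \<open>det2 y b\<close> / \<kappa> for \<open>det2 a y\<close>.\<close>
  define A where "A = (1 / det2 a b) *s a"
  define B where "B = (- 1 / (\<kappa> * det2 a b)) *s b"
  define f where "f = (\<lambda>p :: real \<times> complex. snd p *s A + (fst p *\<^sub>R snd p) *s B)"
  have "f differentiable (at p)" for p
  proof -
    note lin = bounded_linear.has_derivative[OF bounded_linear_smult_vec]
    have "((\<lambda>p. fst p *\<^sub>R snd p) has_derivative (\<lambda>q. fst p *\<^sub>R snd q + fst q *\<^sub>R snd p)) (at p)"
      by (intro has_derivative_scaleR has_derivative_fst has_derivative_snd has_derivative_ident)
    from has_derivative_add[OF lin[OF has_derivative_snd[OF has_derivative_ident], of A] lin[OF this, of B]]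
    show ?thesis
      unfolding f_def differentiable_def by blast
  qed
  then have "negligible (range f)"
    by (intro negligible_differentiable_image_lowdim)
       (auto simp: differentiable_on_def intro: differentiable_at_withinI)
  moreover have "b \<noteq> 0" using d by (auto simp: det2_def)
  ultimately show "negligible (range f \<union> {y. det2 b y = 0})"
    by (intro negligible_Un negligible_det2_zero)
  show "{y. Im (\<kappa> * det2 y a * cnj (det2 y b)) = 0} \<subseteq> range f \<union> {y. det2 b y = 0}"
  proof
    fix y assume y: "y \<in> {y. Im (\<kappa> * det2 y a * cnj (det2 y b)) = 0}"
    show "y \<in> range f \<union> {y. det2 b y = 0}"
    proof (cases "det2 y b = 0")
      case True
      then show ?thesis using det2_swap[of b y] by simp
    next
      case v: False
      define w where "w = \<kappa> * det2 y a * cnj (det2 y b)"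
      define r where "r = Re w / (norm (det2 y b))\<^sup>2"
      have w: "w = of_real (Re w)"
        using y by (simp add: complex_eq_iff w_def)
      have vv: "cnj (det2 y b) * det2 y b = of_real ((norm (det2 y b))\<^sup>2)"
        by (simp only: complex_norm_square mult.commute)
      have "\<kappa> * det2 y a * of_real ((norm (det2 y b))\<^sup>2) = w * det2 y b"
        by (simp only: vv[symmetric] w_def mult.assoc)
      then have "\<kappa> * det2 y a * of_real ((norm (det2 y b))\<^sup>2) = of_real (Re w) * det2 y b"
        using w by simp
      then have u: "\<kappa> * det2 y a = of_real r * det2 y b"
        using v by (simp add: r_def field_simps)
      then have u': "det2 a y = - of_real r * det2 y b / \<kappa>"
        using \<kappa> det2_swap[of a y] by (simp add: field_simps)
      have "y = (1 / det2 a b) *s (det2 a b *s y)"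
        using d by (simp add: vector_smult_assoc)
      also have "\<dots> = f (r, det2 y b)"
        unfolding det2_expansion[of a b y] u' f_def A_def B_def
        using d \<kappa> by (simp add: vec_eq_iff scaleR_conv_of_real field_simps)
      finally show ?thesis by blast
    qed
  qed
qed

text \<open>Fubini: the exceptional set is null because its section in coordinate \<open>i\<close>
  is null for every choice of the other coordinates.\<close>

lemma AE_PiM_insert:
  fixes M :: "'i \<Rightarrow> 'a measure"
  assumes "product_sigma_finite M" and I: "finite I" "i \<notin> I"
    and P: "{x \<in> space (Pi\<^sub>M (insert i I) M). P x} \<in> sets (Pi\<^sub>M (insert i I) M)"
    and AE: "\<And>x. x \<in> space (Pi\<^sub>M I M) \<Longrightarrow> AE y in M i. P (x(i := y))"
  shows "AE x in Pi\<^sub>M (insert i I) M. P x"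
proof -
  interpret product_sigma_finite M by fact
  let ?N = "{x \<in> space (Pi\<^sub>M (insert i I) M). \<not> P x}"
  have N: "?N \<in> sets (Pi\<^sub>M (insert i I) M)"
    using sets.sets_Collect_neg[OF P] .
  have "emeasure (Pi\<^sub>M (insert i I) M) ?N = (\<integral>\<^sup>+x. \<integral>\<^sup>+y. indicator ?N (x(i := y)) \<partial>M i \<partial>Pi\<^sub>M I M)"
    using N by (subst nn_integral_indicator[symmetric], simp, subst product_nn_integral_insert[OF I]) auto
  also have "\<dots> = (\<integral>\<^sup>+x. 0 \<partial>Pi\<^sub>M I M)"
  proof (rule nn_integral_cong)
    fix x assume x: "x \<in> space (Pi\<^sub>M I M)"
    have "AE y in M i. indicator ?N (x(i := y)) = (0 :: ennreal)"
      using AE[OF x] by eventually_elim (simp add: indicator_def)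
    then have "(\<integral>\<^sup>+y. indicator ?N (x(i := y)) \<partial>M i) = (\<integral>\<^sup>+y. 0 \<partial>M i)"
      by (rule nn_integral_cong_AE)
    then show "(\<integral>\<^sup>+y. indicator ?N (x(i := y)) \<partial>M i) = 0" by simp
  qed
  finally have "?N \<in> null_sets (Pi\<^sub>M (insert i I) M)"
    using N by (simp add: null_sets_def)
  then show ?thesis
    by (rule AE_I') auto
qed

lemma AE_lborel_update:
  fixes P :: "(nat \<times> nat \<Rightarrow> complex ^ 2) \<Rightarrow> bool"
  assumes S: "finite S" "i \<in> S"
    and P: "{x \<in> space (Pi\<^sub>M S (\<lambda>_. borel)). P x} \<in> sets (Pi\<^sub>M S (\<lambda>_. borel))"
    and AE: "\<And>x. AE y in lborel. P (x(i := y))"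
  shows "AE x in Pi\<^sub>M S (\<lambda>_. lborel). P x"
proof -
  have eq: "insert i (S - {i}) = S" using S by auto
  have s: "sets (Pi\<^sub>M S (\<lambda>_. lborel :: (complex ^ 2) measure)) = sets (Pi\<^sub>M S (\<lambda>_. borel))"
    by (intro sets_PiM_cong) auto
  have "AE x in Pi\<^sub>M (insert i (S - {i})) (\<lambda>_. lborel). P x"
  proof (rule AE_PiM_insert)
    show "product_sigma_finite (\<lambda>_ :: nat \<times> nat. lborel :: (complex ^ 2) measure)"
      by standard
    show "{x \<in> space (Pi\<^sub>M (insert i (S - {i})) (\<lambda>_. lborel)). P x} \<in> sets (Pi\<^sub>M (insert i (S - {i})) (\<lambda>_. lborel))"
      unfolding eq s sets_eq_imp_space_eq[OF s] by (rule P)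
  qed (use S AE in auto)
  then show ?thesis unfolding eq .
qed

text \<open>One vector is exposed at a time: first \<open>x i\<close> is nonzero, then, with
  \<open>x i\<close> fixed, \<open>x k\<close> avoids the line through it. The implication makes the
  second claim hold for every fixed \<open>x\<close>, as \<open>AE_lborel_update\<close>
  demands.\<close>

lemma AE_det2_nonzero:
  fixes S :: "(nat \<times> nat) set"
  assumes S: "finite S" "i \<in> S" "k \<in> S" "i \<noteq> k"
  shows "AE x in Pi\<^sub>M S (\<lambda>_. lborel :: (complex ^ 2) measure). det2 (x i) (x k) \<noteq> (0 :: complex)"
proof -
  note [measurable] = S(2,3)
  have "AE x in Pi\<^sub>M S (\<lambda>_. lborel). x i \<noteq> (0 :: complex ^ 2)"
  proof (rule AE_lborel_update[OF S(1,2)])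
    show "AE y in lborel. (x(i := y)) i \<noteq> (0 :: complex ^ 2)" for x :: "nat \<times> nat \<Rightarrow> complex ^ 2"
      using AE_lborel_not_in_negligible[of "{0 :: complex ^ 2}"] by simp
    show "{x \<in> space (Pi\<^sub>M S (\<lambda>_. borel)). x i \<noteq> (0 :: complex ^ 2)} \<in> sets (Pi\<^sub>M S (\<lambda>_. borel))"
      by measurable
  qed
  moreover have "AE x in Pi\<^sub>M S (\<lambda>_. lborel). x i \<noteq> 0 \<longrightarrow> det2 (x i) (x k) \<noteq> 0"
  proof (rule AE_lborel_update[OF S(1,3)])
    show "{x \<in> space (Pi\<^sub>M S (\<lambda>_. borel)). x i \<noteq> 0 \<longrightarrow> det2 (x i) (x k) \<noteq> 0} \<in> sets (Pi\<^sub>M S (\<lambda>_. borel))"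
      by measurable
    fix x :: "nat \<times> nat \<Rightarrow> complex ^ 2"
    show "AE y in lborel. (x(k := y)) i \<noteq> 0 \<longrightarrow> det2 ((x(k := y)) i) ((x(k := y)) k) \<noteq> 0"
    proof (cases "x i = 0")
      case False
      have "{y. det2 (x i) y = 0} \<in> sets borel" by measurable
      from AE_lborel_not_in_negligible[OF negligible_det2_zero[OF False] this] show ?thesis
        using S(4) by simp
    qed (use S(4) in simp)
  qed
  ultimately show ?thesis by eventually_elim simp
qed

text \<open>Once the vectors at \<open>q\<close>, \<open>r\<close>, \<open>s\<close> are pairwise
  independent, the vector at \<open>p\<close> only has to avoid the null set of
  \<open>negligible_aligned\<close>.\<close>

lemma AE_cross_ratio_not_real:
  fixes S :: "(nat \<times> nat) set"
  assumes S: "finite S" "p \<in> S" "q \<in> S" "r \<in> S" "s \<in> S"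
    and ne: "p \<noteq> q" "p \<noteq> r" "p \<noteq> s" "q \<noteq> r" "s \<noteq> q" "s \<noteq> r"
  shows "AE h in Pi\<^sub>M S (\<lambda>_. lborel :: (complex ^ 2) measure).
    Im (det2 (h p) (h q) * det2 (h s) (h r) * cnj (det2 (h p) (h r) * det2 (h s) (h q))) \<noteq> 0"
proof -
  note [measurable] = S(2-5)
  let ?M = "Pi\<^sub>M S (\<lambda>_. lborel :: (complex ^ 2) measure)"
  let ?Q = "\<lambda>h :: nat \<times> nat \<Rightarrow> complex ^ 2. det2 (h q) (h r) \<noteq> 0 \<and>
    det2 (h s) (h q) \<noteq> 0 \<and> det2 (h s) (h r) \<noteq> 0"
  let ?R = "\<lambda>h :: nat \<times> nat \<Rightarrow> complex ^ 2.
    Im (det2 (h p) (h q) * det2 (h s) (h r) * cnj (det2 (h p) (h r) * det2 (h s) (h q))) \<noteq> 0"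
  have [measurable]: "Im \<in> borel_measurable borel" "cnj \<in> borel_measurable borel"
    by (intro borel_measurable_continuous_onI continuous_intros)+
  have [measurable]: "Measurable.pred (Pi\<^sub>M S (\<lambda>_. borel)) ?R"
    by measurable
  have "AE h in ?M. det2 (h q) (h r) \<noteq> 0" "AE h in ?M. det2 (h s) (h q) \<noteq> 0"
    "AE h in ?M. det2 (h s) (h r) \<noteq> 0"
    by (intro AE_det2_nonzero S ne)+
  moreover have "AE h in ?M. ?Q h \<longrightarrow> ?R h"
  proof (rule AE_lborel_update[OF S(1,2)])
    show "{h \<in> space (Pi\<^sub>M S (\<lambda>_. borel)). ?Q h \<longrightarrow> ?R h} \<in> sets (Pi\<^sub>M S (\<lambda>_. borel))"
      by measurable
    fix h :: "nat \<times> nat \<Rightarrow> complex ^ 2"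
    let ?\<kappa> = "det2 (h s) (h r) * cnj (det2 (h s) (h q))"
    show "AE y in lborel. ?Q (h(p := y)) \<longrightarrow> ?R (h(p := y))"
    proof (cases "?Q h")
      case True
      then have "det2 (h q) (h r) \<noteq> 0" "?\<kappa> \<noteq> 0" by simp_all
      note neg = negligible_aligned[OF this]
      have "closed {y. Im (?\<kappa> * det2 y (h q) * cnj (det2 y (h r))) = 0}"
        unfolding det2_def by (intro closed_Collect_eq continuous_intros)
      from AE_lborel_not_in_negligible[OF neg borel_closed[OF this]] show ?thesis
      proof eventually_elim
        case (elim y)
        have "Im (det2 y (h q) * det2 (h s) (h r) * cnj (det2 y (h r) * det2 (h s) (h q))) \<noteq> 0"
          using elim by (simp only: mem_Collect_eq complex_cnj_mult mult_ac simp_thms)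
        then show ?case
          using ne by simp
      qed
    next
      case False
      then have "\<not> ?Q (h(p := y))" for y
        using ne by simp
      then show ?thesis
        by (intro AE_I2 impI) (rule notE)
    qed
  qed
  ultimately show ?thesis
    by eventually_elim blast
qed

lemma AE_nondegenerate:
  assumes J: "J 1 = 1" "J 2 = 3"
  shows "AE h in Pi\<^sub>M (states 2 J) (\<lambda>_. lborel). nondegenerate h"
  unfolding nondegenerate_def states_2[OF J]
  by (rule AE_cross_ratio_not_real) simp_all

subsection \<open>The degrees of freedom\<close>

text \<open>Cramer's rule for rows: without noise, the output of user 1 is a fixed combination of
  the outputs at two states of user 2.\<close>

lemma received_combination:
  fixes a b y :: "complex ^ 2"
  assumes "det2 a b \<noteq> 0"
  shows "row_times y x = det2 y b / det2 a b * row_times a x + det2 a y / det2 a b * row_times b x"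
proof -
  have "det2 a b * row_times y x = det2 y b * row_times a x + det2 a y * row_times b x"
    by (simp add: row_times_2 det2_def algebra_simps)
  then show ?thesis
    using assms by (simp add: field_simps)
qed

lemma sum_error_prob_le:
  assumes "error_prob 2 m n x k h g \<le> \<epsilon>" "0 < m 1" "0 < m 2"
  shows "(\<Sum>i<m 1. \<Sum>j<m 2. \<P>(z in noise n. g (received n h (x (pair_message i j)) z) \<noteq> pair_message i j k))
    \<le> real (m 1) * real (m 2) * \<epsilon>"
  using assms unfolding error_prob_def sum_messages_2 card_messages_2
  by (simp add: divide_le_eq mult_ac)

text \<open>\<open>exists_good_message\<close> fixes the message of user 2, and the two volume
  bounds are applied to the surviving messages of user 1. In terms of rates, R1 + 2 R2 <= 2 log P +
  O(1) and R1 <= log P + O(1).\<close>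

lemma code_size_bounds:
  fixes h :: "nat \<times> nat \<Rightarrow> complex ^ 2"
  assumes d: "det2 (h (2, 1)) (h (2, 2)) \<noteq> 0"
  obtains K1 K2 where "0 < K1" "0 < K2"
    "\<And>P n m x g. 1 \<le> P \<Longrightarrow> 2 \<le> n \<Longrightarrow> 0 < m 1 \<Longrightarrow> 0 < m 2 \<Longrightarrow> avg_power 2 m n x \<le> P \<Longrightarrow>
      (\<And>k j. (k, j) \<in> {(1, 1), (2, 1), (2, 2)} \<Longrightarrow>
        g (k, j) \<in> Pi\<^sub>M {..<n} (\<lambda>_. borel) \<rightarrow>\<^sub>M count_space UNIV \<and>
        error_prob 2 m n x k (h (k, j)) (g (k, j)) \<le> 1 / 100) \<Longrightarrow>
      real (m 1) * (real (m 2))\<^sup>2 \<le> (K1 * P\<^sup>2) ^ n \<and> real (m 1) \<le> (K2 * P) ^ n"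
proof -
  let ?y = "h (1, 1)" and ?a = "h (2, 1)" and ?b = "h (2, 2)"
  define \<alpha> where "\<alpha> = det2 ?y ?b / det2 ?a ?b"
  define \<beta> where "\<beta> = det2 ?a ?y / det2 ?a ?b"
  have row: "row_times ?y x = \<alpha> * row_times ?a x + \<beta> * row_times ?b x" for x
    unfolding \<alpha>_def \<beta>_def by (rule received_combination[OF d])
  let ?n = "\<lambda>h :: complex ^ 2. \<Sum>i\<in>UNIV. norm (h $ i)"
  define N where "N = ?n ?y + ?n ?a + ?n ?b"
  have n0: "0 \<le> ?n h" for h by (intro sum_nonneg) simp
  have N: "?n ?y \<le> N" "?n ?a \<le> N" "?n ?b \<le> N"
    unfolding N_def using n0[of ?y] n0[of ?a] n0[of ?b] by linarith+
  define L where "L = 24 * N\<^sup>2 + 8"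
  define \<sigma> where "\<sigma> = 12 * (1 + (norm \<alpha>)\<^sup>2 + (norm \<beta>)\<^sup>2)"
  have L: "0 < L" unfolding L_def by (intro add_nonneg_pos) auto
  have \<sigma>: "0 < \<sigma>" unfolding \<sigma>_def by (intro mult_pos_pos add_pos_nonneg) auto
  \<comment> \<open>576 = 8 * 2 * 36: the 8 of \<open>card_le_product_volume\<close>, the 2 for
    discarding up to half of the messages of user 1, and 6 * 6 for the two volumes. Likewise 4 = 2 *
    2 in \<open>K2\<close>. As n >= 1, these constants fit into the n-th powers.\<close>
  define K1 where "K1 = 576 * (exp 1 * pi * L)\<^sup>2 * (exp 1 * pi * \<sigma>)"
  define K2 where "K2 = 4 * (exp 1 * pi * L)"
  show thesis
  proof (rule that)
    show "0 < K1" "0 < K2"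
      unfolding K1_def K2_def using L \<sigma> by (auto intro!: mult_pos_pos)
    fix P :: real and n :: nat and m and x :: "(nat \<Rightarrow> nat) \<Rightarrow> nat \<Rightarrow> complex ^ 2" and g
    assume P: "1 \<le> P" and n: "2 \<le> n" and m: "0 < m 1" "0 < m 2" and pw: "avg_power 2 m n x \<le> P"
      and dec: "\<And>k j. (k, j) \<in> {(1, 1), (2, 1), (2, 2)} \<Longrightarrow>
        g (k, j) \<in> Pi\<^sub>M {..<n} (\<lambda>_. borel) \<rightarrow>\<^sub>M count_space UNIV \<and>
        error_prob 2 m n x k (h (k, j)) (g (k, j)) \<le> 1 / 100"
    let ?x = "\<lambda>i j. x (pair_message i j)"
    have dec1: "g (1, 1) \<in> Pi\<^sub>M {..<n} (\<lambda>_. borel) \<rightarrow>\<^sub>M count_space UNIV" "error_prob 2 m n x 1 ?y (g (1, 1)) \<le> 1 / 100"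
      and dec2: "g (2, 1) \<in> Pi\<^sub>M {..<n} (\<lambda>_. borel) \<rightarrow>\<^sub>M count_space UNIV" "error_prob 2 m n x 2 ?a (g (2, 1)) \<le> 1 / 100"
      and dec3: "g (2, 2) \<in> Pi\<^sub>M {..<n} (\<lambda>_. borel) \<rightarrow>\<^sub>M count_space UNIV" "error_prob 2 m n x 2 ?b (g (2, 2)) \<le> 1 / 100"
      using dec[of 1 1] dec[of 2 1] dec[of 2 2] by blast+
    define e1 where "e1 i j = \<P>(z in noise n. g (1, 1) (received n ?y (?x i j) z) \<noteq> i)" for i j
    define e2 where "e2 i j = \<P>(z in noise n. g (2, 1) (received n ?a (?x i j) z) \<noteq> j)" for i j
    define e3 where "e3 i j = \<P>(z in noise n. g (2, 2) (received n ?b (?x i j) z) \<noteq> j)" for i j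
    define p where "p i j = (\<Sum>t<n. (norm (?x i j t))\<^sup>2) / real n" for i j
    define \<rho> where "\<rho> = L * P"
    have \<rho>: "0 < \<rho>" unfolding \<rho>_def using L P by simp
    define V where "V = (exp 1 * pi * \<rho>) ^ n"
    have V: "0 < V" unfolding V_def using \<rho> by simp
    define A where "A j = measure (leb n) (region n \<rho> (g (2, 1)) j)" for j
    define B where "B j = measure (leb n) (region n \<rho> (g (2, 2)) j)" for j
    have pm: "pair_message i j 1 = i" "pair_message i j 2 = j" for i j
      by (simp_all add: pair_message_def)
    obtain j G where j: "j < m 2" and A: "A j \<le> 6 * V / real (m 2)" and B: "B j \<le> 6 * V / real (m 2)"
      and G: "G \<subseteq> {..<m 1}" "real (m 1) \<le> 2 * real (card G)"
      and good: "\<And>i. i \<in> G \<Longrightarrow> e1 i j \<le> 1 / 4 \<and> e2 i j \<le> 1 / 4 \<and> e3 i j \<le> 1 / 4 \<and> p i j \<le> 12 * P"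
    proof (rule exists_good_message[OF m _ V])
      show "0 < P" using P by simp
      show "0 \<le> e1 i j" "0 \<le> e2 i j" "0 \<le> e3 i j" "0 \<le> p i j" "0 \<le> A j" "0 \<le> B j" for i j
        unfolding e1_def e2_def e3_def p_def A_def B_def by (auto intro!: divide_nonneg_nonneg sum_nonneg)
      show "(\<Sum>i<m 1. \<Sum>j<m 2. e1 i j) \<le> real (m 1) * real (m 2) / 100"
        using sum_error_prob_le[where k = 1, OF dec1(2) m] unfolding e1_def pm by simp
      show "(\<Sum>i<m 1. \<Sum>j<m 2. e2 i j) \<le> real (m 1) * real (m 2) / 100"
        using sum_error_prob_le[where k = 2, OF dec2(2) m] unfolding e2_def pm by simp
      show "(\<Sum>i<m 1. \<Sum>j<m 2. e3 i j) \<le> real (m 1) * real (m 2) / 100"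
        using sum_error_prob_le[where k = 2, OF dec3(2) m] unfolding e3_def pm by simp
      show "(\<Sum>i<m 1. \<Sum>j<m 2. p i j) \<le> P * (real (m 1) * real (m 2))"
        using pw m unfolding avg_power_def sum_messages_2 card_messages_2 p_def
        by (simp add: divide_le_eq)
      show "(\<Sum>j<m 2. A j) \<le> V" "(\<Sum>j<m 2. B j) \<le> V"
        unfolding A_def B_def V_def
        by (intro sum_measure_region_le[OF dec2(1) \<rho>] sum_measure_region_le[OF dec3(1) \<rho>]; simp)+
    qed (rule that)
    have finG: "finite G" using G(1) finite_subset by blast
    have x: "(\<Sum>t<n. (norm (?x i j t))\<^sup>2) \<le> real n * (12 * P)" if "i \<in> G" for i
      using good[OF that] n unfolding p_def by (simp add: divide_le_eq mult.commute)
    have \<rho>_eq: "\<rho> = (24 * N\<^sup>2 + 8) * P" by (simp add: \<rho>_def L_def)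
    have "real (card G) / 8 \<le> A j * B j * (exp 1 * pi * \<sigma>) ^ n"
      unfolding A_def B_def
    proof (rule card_le_product_volume[where x = "\<lambda>i. ?x i j",
          OF dec1(1) dec2(1) dec3(1) n P N(2,3) row finG _ _ _ x \<rho>_eq \<sigma>_def])
      show "\<P>(z in noise n. g (1, 1) (received n ?y (?x i j) z) \<noteq> i) \<le> 1 / 4"
        "\<P>(z in noise n. g (2, 1) (received n ?a (?x i j) z) \<noteq> j) \<le> 1 / 4"
        "\<P>(z in noise n. g (2, 2) (received n ?b (?x i j) z) \<noteq> j) \<le> 1 / 4" if "i \<in> G" for i
        using good[OF that] unfolding e1_def e2_def e3_def by blast+
    qed
    also have "\<dots> \<le> (6 * V / real (m 2)) * (6 * V / real (m 2)) * (exp 1 * pi * \<sigma>) ^ n"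
      using A B V \<sigma> by (intro mult_right_mono mult_mono) (auto simp: A_def B_def)
    finally have "real (m 1) / 16 \<le> (6 * V / real (m 2)) * (6 * V / real (m 2)) * (exp 1 * pi * \<sigma>) ^ n"
      using G(2) by linarith
    then have "real (m 1) * (real (m 2))\<^sup>2 \<le> 576 * (V\<^sup>2 * (exp 1 * pi * \<sigma>) ^ n)"
      using m by (simp add: field_simps power2_eq_square)
    also have "\<dots> \<le> 576 ^ n * (V\<^sup>2 * (exp 1 * pi * \<sigma>) ^ n)"
      using power_increasing[of 1 n "576 :: real"] n \<sigma> by (intro mult_right_mono) auto
    also have "\<dots> = (576 * (exp 1 * pi * \<rho>)\<^sup>2 * (exp 1 * pi * \<sigma>)) ^ n"
      unfolding V_def power_mult_distrib power_mult[symmetric] by (simp only: mult_ac)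
    also have "576 * (exp 1 * pi * \<rho>)\<^sup>2 * (exp 1 * pi * \<sigma>) = K1 * P\<^sup>2"
      unfolding K1_def \<rho>_def by (simp add: power_mult_distrib)
    finally have 1: "real (m 1) * (real (m 2))\<^sup>2 \<le> (K1 * P\<^sup>2) ^ n" .
    have "real (card G) / 2 \<le> (exp 1 * pi * ((24 * N\<^sup>2 + 8) * P)) ^ n"
    proof (rule card_le_single_volume[where x = "\<lambda>i. ?x i j", OF dec1(1) n P N(1) finG _ x])
      show "\<P>(z in noise n. g (1, 1) (received n ?y (?x i j) z) \<noteq> i) \<le> 1 / 4" if "i \<in> G" for i
        using good[OF that] unfolding e1_def by blast
    qed
    then have "real (m 1) \<le> 4 * V"
      using G(2) unfolding V_def \<rho>_eq by linarith
    also have "\<dots> \<le> 4 ^ n * V"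
      using power_increasing[of 1 n "4 :: real"] n V by (intro mult_right_mono) auto
    also have "\<dots> = (K2 * P) ^ n"
      unfolding V_def K2_def \<rho>_def by (simp only: power_mult_distrib mult_ac)
    finally show "real (m 1) * (real (m 2))\<^sup>2 \<le> (K1 * P\<^sup>2) ^ n \<and> real (m 1) \<le> (K2 * P) ^ n"
      using 1 by simp
  qed
qed

text \<open>Adding the bounds on R1 + 2 R2 and on R1 gives 2 (R1 + R2) <= 3 log P + O(1); halving
  explains \<open>K\<close>.\<close>

lemma sum_capacity_upper_bound:
  fixes h :: "nat \<times> nat \<Rightarrow> complex ^ 2"
  assumes J: "J 1 = 1" "J 2 = 3" and d: "det2 (h (2, 1)) (h (2, 2)) \<noteq> 0"
  shows "\<exists>K. eventually (\<lambda>P. sum_capacity 2 J h P \<le> ereal (3 / 2 * log 2 P + K)) at_top"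
proof -
  obtain K1 K2 where K: "0 < K1" "0 < K2"
    and size: "\<And>P n m x g. 1 \<le> P \<Longrightarrow> 2 \<le> n \<Longrightarrow> 0 < m 1 \<Longrightarrow> 0 < m 2 \<Longrightarrow> avg_power 2 m n x \<le> P \<Longrightarrow>
      (\<And>k j. (k, j) \<in> {(1, 1), (2, 1), (2, 2)} \<Longrightarrow>
        g (k, j) \<in> Pi\<^sub>M {..<n} (\<lambda>_. borel) \<rightarrow>\<^sub>M count_space UNIV \<and>
        error_prob 2 m n x k (h (k, j)) (g (k, j)) \<le> 1 / 100) \<Longrightarrow>
      real (m 1) * (real (m 2))\<^sup>2 \<le> (K1 * P\<^sup>2) ^ n \<and> real (m 1) \<le> (K2 * P) ^ n"
    by (rule code_size_bounds[of h]) (use d in blast)+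
  define K where "K = (log 2 K1 + log 2 K2) / 2"
  have "sum_capacity 2 J h P \<le> ereal (3 / 2 * log 2 P + K)" if P: "1 \<le> P" for P
    unfolding sum_capacity_def
  proof (rule SUP_least)
    have hundredth: "(0 :: real) < 1 / 100" by simp
    fix R assume "R \<in> {R. achievable 2 J h P R}"
    then have "achievable 2 J h P R" by simp
    then have "\<forall>\<epsilon>>0. \<forall>n0. \<exists>n\<ge>n0. \<exists>m x g. (\<forall>k\<in>{1..2}. 2 powr (real n * R k) \<le> real (m k)) \<and>
        avg_power 2 m n x \<le> P \<and>
        (\<forall>(k, j)\<in>states 2 J. g (k, j) \<in> Pi\<^sub>M {..<n} (\<lambda>_. borel) \<rightarrow>\<^sub>M count_space UNIV \<and>
           error_prob 2 m n x k (h (k, j)) (g (k, j)) \<le> \<epsilon>)"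
      unfolding achievable_def by blast
    \<comment> \<open>A single code with error 1/100 and block length at least 2 suffices: the size
      bounds are n-th powers, so n cancels in the rates.\<close>
    from this[THEN spec, of "1 / 100", THEN mp, OF hundredth, THEN spec, of 2] obtain n m x g where n: "2 \<le> n"
      and rate: "\<forall>k\<in>{1..2}. 2 powr (real n * R k) \<le> real (m k)"
      and pw: "avg_power 2 m n x \<le> P"
      and dec: "\<forall>(k, j)\<in>states 2 J. g (k, j) \<in> Pi\<^sub>M {..<n} (\<lambda>_. borel) \<rightarrow>\<^sub>M count_space UNIV \<and>
           error_prob 2 m n x k (h (k, j)) (g (k, j)) \<le> 1 / 100"
      by blast
    have r1: "2 powr (real n * R 1) \<le> real (m 1)" and r2: "2 powr (real n * R 2) \<le> real (m 2)"
      by (rule rate[THEN bspec], simp)+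
    have "0 < 2 powr (real n * R 1)" "0 < 2 powr (real n * R 2)" by simp_all
    then have m: "0 < m 1" "0 < m 2"
      using r1 r2 by linarith+
    have *: "real (m 1) * (real (m 2))\<^sup>2 \<le> (K1 * P\<^sup>2) ^ n \<and> real (m 1) \<le> (K2 * P) ^ n"
    proof (rule size[OF P n m pw])
      fix k j :: nat assume "(k, j) \<in> {(1, 1), (2, 1), (2, 2)}"
      then have "(k, j) \<in> states 2 J" unfolding states_2[OF J] by blast
      then show "g (k, j) \<in> Pi\<^sub>M {..<n} (\<lambda>_. borel) \<rightarrow>\<^sub>M count_space UNIV \<and>
          error_prob 2 m n x k (h (k, j)) (g (k, j)) \<le> 1 / 100"
        using dec by blast
    qed
    have rate_le: "r \<le> log 2 X" if "2 powr (real n * r) \<le> X ^ n" "0 < X" for r X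
    proof -
      have "real n * r = log 2 (2 powr (real n * r))" by simp
      also have "\<dots> \<le> log 2 (X ^ n)"
        using that by (subst log_le_cancel_iff) auto
      also have "\<dots> = real n * log 2 X"
        using that by (simp add: log_nat_power)
      finally show ?thesis using n by simp
    qed
    have "2 powr (real n * (R 1 + 2 * R 2)) = 2 powr (real n * R 1) * (2 powr (real n * R 2))\<^sup>2"
      by (simp add: power2_eq_square powr_add[symmetric] algebra_simps)
    also have "\<dots> \<le> real (m 1) * (real (m 2))\<^sup>2"
      using r1 r2 by (intro mult_mono power_mono) auto
    also have "\<dots> \<le> (K1 * P\<^sup>2) ^ n" using * by blast
    finally have "R 1 + 2 * R 2 \<le> log 2 (K1 * P\<^sup>2)"
      using K P by (intro rate_le) auto
    moreover have "2 powr (real n * R 1) \<le> (K2 * P) ^ n" using r1 * by linarith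
    then have "R 1 \<le> log 2 (K2 * P)"
      using K P by (intro rate_le) auto
    moreover have "log 2 (K1 * P\<^sup>2) = log 2 K1 + 2 * log 2 P"
      using K P by (simp add: log_mult log_nat_power)
    moreover have "log 2 (K2 * P) = log 2 K2 + log 2 P"
      using K P by (simp add: log_mult)
    ultimately have "R 1 + R 2 \<le> 3 / 2 * log 2 P + K"
      unfolding K_def by (simp add: field_simps)
    moreover have "{1..2::nat} = {1, 2}" by auto
    ultimately show "ereal (\<Sum>k = 1..2. R k) \<le> ereal (3 / 2 * log 2 P + K)"
      by simp
  qed
  then show ?thesis
    unfolding eventually_at_top_linorder by blast
qed

lemma has_dof_nondegenerate:
  fixes h :: "nat \<times> nat \<Rightarrow> complex ^ 2"
  assumes J: "J 1 = 1" "J 2 = 3" and h: "nondegenerate h"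
  shows "has_dof 2 J h (3 / 2)"
proof -
  obtain K where lower: "eventually (\<lambda>P. ereal (3 / 2 * log 2 P - K) \<le> sum_capacity 2 J h P) at_top"
    using sum_capacity_lower_bound[where J = J, OF J h] by blast
  obtain K' where upper: "eventually (\<lambda>P. sum_capacity 2 J h P \<le> ereal (3 / 2 * log 2 P + K')) at_top"
    using sum_capacity_upper_bound[where J = J, OF J nondegenerate_det2(4)[OF h]] by blast
  have lim: "((\<lambda>P. ereal (3 / 2 + c / log 2 P)) \<longlongrightarrow> ereal (3 / 2)) at_top" for c
  proof -
    have "((\<lambda>P. c / log 2 P) \<longlongrightarrow> 0) at_top"
      by real_asymp
    from tendsto_add[OF tendsto_const this, of "3 / 2"] show ?thesis
      by (intro tendsto_ereal) simp
  qed
  have eq: "ereal (3 / 2 * log 2 P + c) / ereal (log 2 P) = ereal (3 / 2 + c / log 2 P)" if "1 < P" for P c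
  proof -
    have "0 < log 2 P" using that by simp
    then have "log 2 P \<noteq> 0" by linarith
    then show ?thesis by (simp add: field_simps)
  qed
  show ?thesis
    unfolding has_dof_def
  proof (rule tendsto_sandwich[OF _ _ lim[of "- K"] lim[of K']])
    show "eventually (\<lambda>P. ereal (3 / 2 + - K / log 2 P) \<le> sum_capacity 2 J h P / ereal (log 2 P)) at_top"
      using lower eventually_gt_at_top[of 1]
    proof eventually_elim
      case (elim P)
      have "ereal (3 / 2 * log 2 P + - K) / ereal (log 2 P) \<le> sum_capacity 2 J h P / ereal (log 2 P)"
        using elim by (intro ereal_divide_right_mono) simp_all
      then show ?case unfolding eq[OF elim(2)] .
    qed
    show "eventually (\<lambda>P. sum_capacity 2 J h P / ereal (log 2 P) \<le> ereal (3 / 2 + K' / log 2 P)) at_top"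
      using upper eventually_gt_at_top[of 1]
    proof eventually_elim
      case (elim P)
      have "sum_capacity 2 J h P / ereal (log 2 P) \<le> ereal (3 / 2 * log 2 P + K') / ereal (log 2 P)"
        using elim by (intro ereal_divide_right_mono) simp_all
      then show ?case unfolding eq[OF elim(2)] .
    qed
  qed
qed

theorem theorem1:
  fixes J :: "nat \<Rightarrow> nat"
    and \<mu> :: "(nat \<times> nat \<Rightarrow> complex ^ 2) measure"
  assumes "J 1 = 1" and "J 2 = 3"
    and "continuous_channel_law 2 J \<mu>"
  shows "AE h in \<mu>. has_dof 2 J h (3 / 2)"
proof -
  let ?L = "Pi\<^sub>M (states 2 J) (\<lambda>_. lborel) :: (nat \<times> nat \<Rightarrow> complex ^ 2) measure"
  have \<mu>: "sets \<mu> = sets ?L" "absolutely_continuous ?L \<mu>"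
    using assms(3) by (simp_all add: continuous_channel_law_def)
  have "AE h in \<mu>. nondegenerate h"
    by (rule absolutely_continuous_AE[OF \<mu>]) (rule AE_nondegenerate[OF assms(1,2)])
  then show ?thesis
    by eventually_elim (rule has_dof_nondegenerate[OF assms(1,2)])
qed

end
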